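(* Let $\mathfrak F$ be a free filter on $\mathbb N$ and $(a_n)_{n\in\mathbb N}\subset(1,\infty)$ be a sequence of reals. Then the following conditions are equivalent: (i) There is an $\mathfrak F$-basis, with continuous coordinate functionals, of an infinite-dimensional real Hilbert space $H$ whose partial sums operators $S_n$ satisfy $\|S_n\|=a_n$ for all $n\in\mathbb N$. (ii) The sequence $(a_n)_{n\in\mathbb N}$ is $(\mathfrak F,2)$-admissible, i.e. $\sum_{n\in I}a_n^{-2}=\infty$ for every $\mathfrak F$-stationary set $I\subset\mathbb N$.
   Context: A filter $\mathfrak F$ on $\mathbb N$ is a non-empty family of subsets of $\mathbb N$ with $\emptyset\notin\mathfrak F$, closed under finite intersections and supersets; it is free if it contains every subset of $\mathbb N$ with finite complement. A set $I\subset\mathbb N$ is $\mathfrak F$-stationary if $I\cap A\ne\emptyset$ for every $A\in\mathfrak F$. A sequence $(x_n)$ in a topological space is $\mathfrak F$-convergent to $x$ if $\{n\in\mathbb N:x_n\in U\}\in\mathfrak F$ for every neighborhood $U$ of $x$. $\mathfrak F$-basis: a sequence $(u_k)_{k\in\mathbb N}$ in a Banach space $X$ is an $\mathfrak F$-basis of $X$ if for every $x\in X$ there is a unique sequence of scalars $(c_k)$ such that the partial sums $\sum_{k=1}^n c_k u_k$ are $\mathfrak F$-convergent (in $n$) in norm to $x$. The coordinate functionals are $u_k^*:x\mapsto c_k$, and the partial sums operators are $S_n(x)=\sum_{k=1}^n u_k^*(x)u_k$; when the coordinate functionals are continuous, $\|S_n\|$ is the operator norm. *)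

theory Defs
  imports "HOL-Analysis.Analysis"
begin

section \<open>Filters on the natural numbers\<close>

text \<open>
  A filter on the naturals is an element \<open>F\<close> of the type \<open>nat filter\<close>, and membership of a set
  \<open>A\<close> in the filter is \<open>eventually (\<lambda>n. n \<in> A) F\<close>. The type also contains the improper filter
  \<open>bot\<close>, which has the empty set as a member and must be excluded. With this reading,
  \<open>F\<close>-convergence of \<open>f\<close> to \<open>x\<close> is literally \<open>(f \<longlongrightarrow> x) F\<close>.
\<close>

definition free_filter :: "nat filter \<Rightarrow> bool" where
  "free_filter F \<longleftrightarrow> F \<noteq> bot \<and> (\<forall>A. finite (- A) \<longrightarrow> eventually (\<lambda>n. n \<in> A) F)"

definition stationary :: "nat filter \<Rightarrow> nat set \<Rightarrow> bool" where
  "stationary F I \<longleftrightarrow> (\<forall>A. eventually (\<lambda>n. n \<in> A) F \<longrightarrow> I \<inter> A \<noteq> {})"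

text \<open>The sum of the nonnegative terms is taken in \<open>[0, \<infinity>]\<close>, where it always exists.\<close>

definition admissible :: "nat filter \<Rightarrow> real \<Rightarrow> (nat \<Rightarrow> real) \<Rightarrow> bool" where
  "admissible F p a \<longleftrightarrow>
     (\<forall>I. stationary F I \<longrightarrow> (\<Sum>\<^sub>\<infinity>n\<in>I. ennreal (a n powr (- p))) = \<infinity>)"

section \<open>Bases with respect to a filter\<close>

text \<open>
  Sequences are indexed from 0, so the partial sum with index \<open>n\<close> runs over \<open>k \<le> n\<close>. This is the
  convention of sequences starting at 1 and sums over \<open>1 \<le> k \<le> n\<close>, with all indices
  (including those on which the filter lives) relabelled simultaneously.
\<close>

definition filter_basis :: "nat filter \<Rightarrow> (nat \<Rightarrow> 'a::banach) \<Rightarrow> bool" where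
  "filter_basis F u \<longleftrightarrow>
     (\<forall>x. \<exists>!c::nat \<Rightarrow> real. ((\<lambda>n. \<Sum>k\<le>n. c k *\<^sub>R u k) \<longlongrightarrow> x) F)"

definition coordinate :: "nat filter \<Rightarrow> (nat \<Rightarrow> 'a::banach) \<Rightarrow> nat \<Rightarrow> 'a \<Rightarrow> real" where
  "coordinate F u k x = (THE c::nat \<Rightarrow> real. ((\<lambda>n. \<Sum>j\<le>n. c j *\<^sub>R u j) \<longlongrightarrow> x) F) k"

definition partial_sum :: "nat filter \<Rightarrow> (nat \<Rightarrow> 'a::banach) \<Rightarrow> nat \<Rightarrow> 'a \<Rightarrow> 'a" where
  "partial_sum F u n x = (\<Sum>k\<le>n. coordinate F u k x *\<^sub>R u k)"

definition infinite_dimensional :: "'a::real_vector set \<Rightarrow> bool" where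
  "infinite_dimensional V \<longleftrightarrow> \<not> (\<exists>B. finite B \<and> V \<subseteq> span B)"

text \<open>
  The real Hilbert spaces are the types of sort \<open>{real_inner, banach}\<close>.
\<close>

definition hilbert_filter_basis_with_norms ::
    "nat filter \<Rightarrow> (nat \<Rightarrow> real) \<Rightarrow> (nat \<Rightarrow> 'h::{real_inner, banach}) \<Rightarrow> bool" where
  "hilbert_filter_basis_with_norms F a u \<longleftrightarrow>
     infinite_dimensional (UNIV :: 'h set) \<and>
     filter_basis F u \<and>
     (\<forall>k. continuous_on UNIV (coordinate F u k)) \<and>
     (\<forall>n. onorm (partial_sum F u n) = a n)"

section \<open>The Hilbert space of square-summable sequences\<close>

text \<open>
  Types cannot be quantified inside a formula. Of the equivalence, the implication from the
  existence of a basis is therefore stated for an arbitrary Hilbert space type, and the converse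
  exhibits the concrete space defined here; taking this space for the arbitrary type gives back
  a single equivalence. No generality is lost: a space with a filter basis is separable, because the linear span of
  the basis is dense, and every infinite-dimensional separable real Hilbert space is isometric
  to this one.
\<close>

typedef ell2 = "{x :: nat \<Rightarrow> real. summable (\<lambda>n. (x n)\<^sup>2)}"
  by (rule exI[of _ "\<lambda>_. 0"]) simp

setup_lifting type_definition_ell2

lemma summable_sq_mult:
  fixes x y :: "nat \<Rightarrow> real"
  assumes "summable (\<lambda>n. (x n)\<^sup>2)" "summable (\<lambda>n. (y n)\<^sup>2)"
  shows "summable (\<lambda>n. x n * y n)"
proof (rule summable_comparison_test')
  show "summable (\<lambda>n. (x n)\<^sup>2 + (y n)\<^sup>2)"
    using assms by (rule summable_add)
  fix n :: nat
  have "2 * (\<bar>x n\<bar> * \<bar>y n\<bar>) \<le> (x n)\<^sup>2 + (y n)\<^sup>2"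
    using sum_squares_bound[of "\<bar>x n\<bar>" "\<bar>y n\<bar>"] by simp
  moreover have "0 \<le> \<bar>x n\<bar> * \<bar>y n\<bar>" by simp
  ultimately show "norm (x n * y n) \<le> (x n)\<^sup>2 + (y n)\<^sup>2"
    by (simp only: real_norm_def abs_mult)
qed

lemma summable_sq_add:
  fixes x y :: "nat \<Rightarrow> real"
  assumes "summable (\<lambda>n. (x n)\<^sup>2)" "summable (\<lambda>n. (y n)\<^sup>2)"
  shows "summable (\<lambda>n. (x n + y n)\<^sup>2)"
proof -
  have "summable (\<lambda>n. (x n)\<^sup>2 + (y n)\<^sup>2 + 2 * (x n * y n))"
    by (intro summable_add summable_mult summable_sq_mult assms)
  then show ?thesis by (simp add: power2_sum mult.assoc)
qed

instantiation ell2 :: real_vector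
begin

lift_definition zero_ell2 :: ell2 is "\<lambda>_. 0" by simp

lift_definition plus_ell2 :: "ell2 \<Rightarrow> ell2 \<Rightarrow> ell2" is "\<lambda>x y n. x n + y n"
  by (rule summable_sq_add)

lift_definition uminus_ell2 :: "ell2 \<Rightarrow> ell2" is "\<lambda>x n. - x n" by simp

lift_definition minus_ell2 :: "ell2 \<Rightarrow> ell2 \<Rightarrow> ell2" is "\<lambda>x y n. x n - y n"
  subgoal for x y using summable_sq_add[of x "\<lambda>n. - y n"] by simp
  done

lift_definition scaleR_ell2 :: "real \<Rightarrow> ell2 \<Rightarrow> ell2" is "\<lambda>r x n. r * x n"
  by (simp add: power_mult_distrib summable_mult)

instance
  by standard (transfer; simp add: fun_eq_iff algebra_simps)+

end

instantiation ell2 :: real_inner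
begin

lift_definition inner_ell2 :: "ell2 \<Rightarrow> ell2 \<Rightarrow> real" is "\<lambda>x y. \<Sum>n. x n * y n" .

definition norm_ell2 :: "ell2 \<Rightarrow> real" where
  "norm_ell2 x = sqrt (inner x x)"

definition sgn_ell2 :: "ell2 \<Rightarrow> ell2" where
  "sgn_ell2 x = x /\<^sub>R norm x"

definition dist_ell2 :: "ell2 \<Rightarrow> ell2 \<Rightarrow> real" where
  "dist_ell2 x y = norm (x - y)"

definition uniformity_ell2 :: "(ell2 \<times> ell2) filter" where
  "uniformity_ell2 = (INF e\<in>{0<..}. principal {(x, y). dist x y < e})"

definition open_ell2 :: "ell2 set \<Rightarrow> bool" where
  "open_ell2 U \<longleftrightarrow> (\<forall>x\<in>U. eventually (\<lambda>(x', y). x' = x \<longrightarrow> y \<in> U) uniformity)"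

instance
proof
  fix x y z :: ell2 and r :: real and U :: "ell2 set"
  show "dist x y = norm (x - y)" by (rule dist_ell2_def)
  show "sgn x = x /\<^sub>R norm x" by (rule sgn_ell2_def)
  show "norm x = sqrt (inner x x)" by (rule norm_ell2_def)
  show "uniformity = (INF e\<in>{0<..}. principal {(x, y::ell2). dist x y < e})"
    by (rule uniformity_ell2_def)
  show "open U \<longleftrightarrow> (\<forall>x\<in>U. \<forall>\<^sub>F (x', y) in uniformity. x' = x \<longrightarrow> y \<in> U)"
    by (rule open_ell2_def)
  show "inner x y = inner y x" by transfer (simp add: mult.commute)
  show "inner (x + y) z = inner x z + inner y z"
    by transfer (simp add: distrib_right suminf_add summable_sq_mult)
  show "inner (r *\<^sub>R x) y = r * inner x y"
    by transfer (simp add: mult.assoc suminf_mult summable_sq_mult)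
  show "0 \<le> inner x x"
    by transfer (simp add: suminf_nonneg summable_sq_mult)
  show "inner x x = 0 \<longleftrightarrow> x = 0"
    by transfer (simp add: suminf_eq_zero_iff summable_sq_mult fun_eq_iff)
qed

end

lemma coord_square_summable: "summable (\<lambda>n. (Rep_ell2 x n)\<^sup>2)"
  using Rep_ell2[of x] by simp

lemma norm_ell2_square: "(norm (x::ell2))\<^sup>2 = (\<Sum>n. (Rep_ell2 x n)\<^sup>2)"
  unfolding power2_norm_eq_inner inner_ell2.rep_eq by (simp add: power2_eq_square)

lemma sum_coord_le_norm_ell2: "(\<Sum>n<N. (Rep_ell2 x n)\<^sup>2) \<le> (norm x)\<^sup>2"
  unfolding norm_ell2_square
  by (rule sum_le_suminf) (auto intro: coord_square_summable)

lemma abs_coord_le_norm_ell2: "\<bar>Rep_ell2 x n\<bar> \<le> norm x"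
proof -
  have "(Rep_ell2 x n)\<^sup>2 \<le> (\<Sum>k<Suc n. (Rep_ell2 x k)\<^sup>2)"
    by (rule member_le_sum) auto
  also have "\<dots> \<le> (norm x)\<^sup>2" by (rule sum_coord_le_norm_ell2)
  finally show ?thesis by (simp add: abs_le_square_iff[symmetric])
qed

instance ell2 :: banach
proof
  fix X :: "nat \<Rightarrow> ell2"
  assume X: "Cauchy X"
  have "Cauchy (\<lambda>m. Rep_ell2 (X m) k)" for k
  proof (rule metric_CauchyI)
    fix e :: real assume "e > 0"
    then obtain M where M: "\<And>m n. m \<ge> M \<Longrightarrow> n \<ge> M \<Longrightarrow> norm (X m - X n) < e"
      using CauchyD[OF X] by blast
    have "dist (Rep_ell2 (X m) k) (Rep_ell2 (X n) k) < e" if "m \<ge> M" "n \<ge> M" for m n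
      using abs_coord_le_norm_ell2[of "X m - X n" k] M[OF that]
      by (simp add: dist_real_def minus_ell2.rep_eq)
    then show "\<exists>M. \<forall>m\<ge>M. \<forall>n\<ge>M. dist (Rep_ell2 (X m) k) (Rep_ell2 (X n) k) < e" by blast
  qed
  then have "\<forall>k. \<exists>l. (\<lambda>m. Rep_ell2 (X m) k) \<longlonglongrightarrow> l"
    using Cauchy_convergent convergent_def by blast
  then obtain l where l: "\<And>k. (\<lambda>m. Rep_ell2 (X m) k) \<longlonglongrightarrow> l k" by metis
  have tail: "\<exists>M. \<forall>m\<ge>M. \<forall>N. (\<Sum>k<N. (Rep_ell2 (X m) k - l k)\<^sup>2) \<le> e\<^sup>2" if "e > 0" for e :: real
  proof -
    obtain M where M: "\<And>m n. m \<ge> M \<Longrightarrow> n \<ge> M \<Longrightarrow> norm (X m - X n) < e"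
      using CauchyD[OF X \<open>e > 0\<close>] by blast
    have "(\<Sum>k<N. (Rep_ell2 (X m) k - l k)\<^sup>2) \<le> e\<^sup>2" if m: "m \<ge> M" for m N
    proof (rule LIMSEQ_le_const2)
      show "(\<lambda>n. \<Sum>k<N. (Rep_ell2 (X m) k - Rep_ell2 (X n) k)\<^sup>2)
              \<longlonglongrightarrow> (\<Sum>k<N. (Rep_ell2 (X m) k - l k)\<^sup>2)"
        by (intro tendsto_intros l)
      have "(\<Sum>k<N. (Rep_ell2 (X m) k - Rep_ell2 (X n) k)\<^sup>2) \<le> e\<^sup>2" if "n \<ge> M" for n
      proof -
        have "(\<Sum>k<N. (Rep_ell2 (X m) k - Rep_ell2 (X n) k)\<^sup>2) \<le> (norm (X m - X n))\<^sup>2"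
          using sum_coord_le_norm_ell2[of "X m - X n" N] by (simp add: minus_ell2.rep_eq)
        also have "\<dots> \<le> e\<^sup>2"
          using M[OF m that] by (intro power_mono) auto
        finally show ?thesis .
      qed
      then show "\<exists>M. \<forall>n\<ge>M. (\<Sum>k<N. (Rep_ell2 (X m) k - Rep_ell2 (X n) k)\<^sup>2) \<le> e\<^sup>2" by blast
    qed
    then show ?thesis by blast
  qed
  obtain m0 where m0: "\<And>N. (\<Sum>k<N. (Rep_ell2 (X m0) k - l k)\<^sup>2) \<le> 1\<^sup>2"
    using tail[of 1] by auto
  have "summable (\<lambda>k. (Rep_ell2 (X m0) k - l k)\<^sup>2)"
    by (rule summableI_nonneg_bounded[OF _ m0]) simp
  then have "summable (\<lambda>k. (l k - Rep_ell2 (X m0) k)\<^sup>2)"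
    by (simp add: power2_commute)
  from summable_sq_add[OF this coord_square_summable[of "X m0"]]
  have suml: "summable (\<lambda>k. (l k)\<^sup>2)" by simp
  define L where "L = Abs_ell2 l"
  have L: "Rep_ell2 L = l" unfolding L_def using suml by (simp add: Abs_ell2_inverse)
  have "X \<longlonglongrightarrow> L"
  proof (rule LIMSEQ_I)
    fix e :: real assume "e > 0"
    then obtain M where M: "\<And>m N. m \<ge> M \<Longrightarrow> (\<Sum>k<N. (Rep_ell2 (X m) k - l k)\<^sup>2) \<le> (e / 2)\<^sup>2"
      using tail[of "e / 2"] by auto
    have "norm (X m - L) < e" if "m \<ge> M" for m
    proof -
      have "(norm (X m - L))\<^sup>2 \<le> (e / 2)\<^sup>2"
        unfolding norm_ell2_square
        by (rule suminf_le_const[OF coord_square_summable])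
          (simp only: minus_ell2.rep_eq L M[OF that])
      then have "norm (X m - L) \<le> e / 2"
        using \<open>e > 0\<close> by (simp add: power2_le_iff_abs_le)
      then show ?thesis using \<open>e > 0\<close> by simp
    qed
    then show "\<exists>M. \<forall>m\<ge>M. norm (X m - L) < e" by blast
  qed
  then show "convergent X" by (rule convergentI)
qed

end

theory Submission
  imports Defs "HOL-Complex_Analysis.Great_Picard"
begin

text \<open>
  \<^bold>\<open>From a basis to admissibility.\<close> Suppose that \<open>\<Sum>n\<in>I. a n powr -2\<close> is finite. It suffices to
  find a vector at which all partial sums operators \<open>S n\<close> with index in a tail of \<open>I\<close> have norm at
  least a constant that exceeds the norm of the vector: its partial sums converge to it along \<open>F\<close>,
  so that tail of \<open>I\<close> misses a member of \<open>F\<close>, and \<open>I\<close> is not stationary. A real vector with this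
  property has to avoid centred planks, and planks of widths \<open>1 / a n\<close> can cover a real plane as
  soon as the sum of their widths diverges. A complex plank is the preimage of a disc and
  not of an interval, so there the squares of the widths count. Therefore \<^emph>\<open>two\<close> real vectors, that
  is, one vector \<open>(x, y)\<close> of the complexified space, are used. If both have convergent partial
  sums, then so does \<open>(norm (S n x))\<^sup>2 + (norm (S n y))\<^sup>2\<close>, and this suffices.

  What is needed is thus a complex plank theorem (Ball) with a constant that is not optimal, lemma
  \<open>complex_plank\<close>. For finitely many forms, the vector is a near-maximiser of a product of powers
  of the moduli of the forms times a Gaussian. If the form number \<open>k\<close> is too small there, then the
  maximum modulus principle on a disc in the complex direction of the vector \<open>h k\<close> finds a point
  where the product is much larger. A weak compactness argument then treats infinitely many forms.

  \<^bold>\<open>From admissibility to a basis.\<close> Let \<open>e\<close> be the standard orthonormal basis. The vectors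
  \<open>u 0 = e 0\<close> and \<open>u (n + 1) = e (n + 1) - g n *\<^sub>R u n\<close> have the biorthogonal functionals
  \<open>x n + g n * x (n + 1)\<close>, and the partial sums telescope: the one with index \<open>n\<close> is the orthogonal
  truncation of \<open>x\<close> plus \<open>x (n + 1) * g n\<close> times \<open>u n\<close>. Its norm as an operator is
  \<open>sqrt (1 + (norm (g n *\<^sub>R u n))\<^sup>2)\<close>, so the numbers \<open>g n\<close> can be chosen recursively to make it
  equal to \<open>a n\<close>. The error term is at most \<open>a n * \<bar>x (n + 1)\<bar>\<close>, and admissibility is exactly what
  makes this tend to 0 along \<open>F\<close> for every square-summable \<open>x\<close>.
\<close>

lemma free_filter_le_sequentially:
  assumes "free_filter F"
  shows "F \<le> sequentially"
  unfolding le_sequentially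
proof
  fix N :: nat
  have "finite (- {N..})" by (simp add: Compl_atLeast)
  then have "\<forall>\<^sub>F n in F. n \<in> {N..}"
    using assms unfolding free_filter_def by blast
  then show "\<forall>\<^sub>F n in F. N \<le> n" by simp
qed

section \<open>Products of complexified linear forms\<close>

text \<open>
  On the circle, the factor \<open>y + \<zeta>\<close> has the same modulus as its reflection
  \<open>s + cnj y * \<zeta> / s\<close>, which has modulus \<open>s\<close> at the centre. The maximum modulus principle applies
  to the product with the reflected factor. When \<open>y\<close> is small, this is a gain by the factor
  \<open>(s / norm y) ^ m\<close> over the value at the centre of \<open>(y + \<zeta>) ^ m * P \<zeta>\<close>.
\<close>

lemma power_mult_entire_le_on_circle:
  fixes P :: "complex \<Rightarrow> complex"
  assumes holP: "P holomorphic_on UNIV" and s: "s > 0"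
  obtains \<zeta> where "norm \<zeta> = s" "s ^ m * norm (P 0) \<le> norm (y + \<zeta>) ^ m * norm (P \<zeta>)"
proof -
  define f where "f \<zeta> = (of_real s + cnj y * \<zeta> / of_real s) ^ m * P \<zeta>" for \<zeta>
  have reflect: "norm (of_real s + cnj y * \<zeta> / of_real s) = norm (y + \<zeta>)" if "norm \<zeta> = s" for \<zeta>
  proof -
    have "\<zeta> * cnj \<zeta> = of_real s * of_real s"
      using that by (simp add: complex_norm_square[symmetric] power2_eq_square[symmetric])
    then have "of_real s + cnj y * \<zeta> / of_real s = \<zeta> / of_real s * cnj (y + \<zeta>)"
      using s by (simp add: field_simps)
    then have "norm (of_real s + cnj y * \<zeta> / of_real s) = norm (\<zeta> / of_real s) * norm (cnj (y + \<zeta>))"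
      by (simp only: norm_mult)
    then show ?thesis
      using that s by (simp add: norm_divide del: complex_cnj_add)
  qed
  have holf: "f holomorphic_on UNIV"
    unfolding f_def using holP s by (intro holomorphic_intros) auto
  then have contf: "continuous_on A f" for A
    using holomorphic_on_imp_continuous_on continuous_on_subset by blast
  have "sphere (0::complex) s \<noteq> {}" using s by simp
  then obtain \<zeta> where \<zeta>: "\<zeta> \<in> sphere 0 s" "\<And>w. w \<in> sphere 0 s \<Longrightarrow> norm (f w) \<le> norm (f \<zeta>)"
    using continuous_attains_sup[of "sphere 0 s" "\<lambda>w. norm (f w)"]
      continuous_on_norm[OF contf] compact_sphere by blast
  have "norm (f 0) \<le> norm (f \<zeta>)"
  proof (rule maximum_modulus_frontier[of f "cball 0 s"])
    show "f holomorphic_on interior (cball 0 s)"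
      using holf holomorphic_on_subset by blast
    show "norm (f z) \<le> norm (f \<zeta>)" if "z \<in> frontier (cball 0 s)" for z
      using \<zeta>(2) that s by simp
  qed (use contf s in auto)
  moreover have "norm (f 0) = s ^ m * norm (P 0)"
    using s by (simp add: f_def norm_mult norm_power)
  moreover have "norm (f \<zeta>) = norm (y + \<zeta>) ^ m * norm (P \<zeta>)"
    using \<zeta>(1) by (simp add: f_def norm_mult norm_power reflect)
  ultimately show ?thesis using that \<zeta>(1) by simp
qed

text \<open>
  The pairs of vectors \<open>(x, y)\<close> represent the vectors \<open>x + \<i> y\<close> of the complexified space, and
  this is the complex-linear extension of a real form.
\<close>

definition complex_form :: "('h \<Rightarrow> real) \<Rightarrow> 'h \<times> 'h \<Rightarrow> complex" where
  "complex_form \<phi> z = Complex (\<phi> (fst z)) (\<phi> (snd z))"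

lemma bounded_linear_complex_form:
  assumes "bounded_linear \<phi>"
  shows "bounded_linear (complex_form \<phi>)"
proof -
  have "bounded_linear (\<lambda>z. complex_of_real (\<phi> (fst z)) + \<i> * complex_of_real (\<phi> (snd z)))"
    by (intro bounded_linear_add bounded_linear_const_mult
        bounded_linear_compose[OF bounded_linear_of_real] bounded_linear_compose[OF assms]
        bounded_linear_fst bounded_linear_snd)
  then show ?thesis
    by (simp add: complex_form_def[abs_def] Complex_eq)
qed

lemma norm_complex_form_le:
  assumes "\<And>x. \<bar>\<phi> x\<bar> \<le> B * norm x"
  shows "norm (complex_form \<phi> z) \<le> \<bar>B\<bar> * norm z"
proof (rule power2_le_imp_le)
  have sq: "(\<phi> x)\<^sup>2 \<le> B\<^sup>2 * (norm x)\<^sup>2" for x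
    using power_mono[OF assms[of x], of 2] by (simp add: power_mult_distrib)
  have "(norm (complex_form \<phi> z))\<^sup>2 = (\<phi> (fst z))\<^sup>2 + (\<phi> (snd z))\<^sup>2"
    by (simp add: complex_form_def cmod_power2)
  also have "\<dots> \<le> B\<^sup>2 * (norm (fst z))\<^sup>2 + B\<^sup>2 * (norm (snd z))\<^sup>2"
    by (intro add_mono sq)
  also have "\<dots> = (\<bar>B\<bar> * norm z)\<^sup>2"
    by (simp add: norm_prod_def power_mult_distrib algebra_simps)
  finally show "(norm (complex_form \<phi> z))\<^sup>2 \<le> (\<bar>B\<bar> * norm z)\<^sup>2" .
qed simp

text \<open>
  The kernels are proper subspaces, and finitely many of them do not cover a real vector space: on
  a line that is not contained in a kernel, each of the forms excludes at most one point.
\<close>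

lemma linear_forms_common_nonzero:
  fixes \<phi> :: "'i \<Rightarrow> 'h::real_vector \<Rightarrow> real"
  assumes "finite J" "\<And>j. j \<in> J \<Longrightarrow> linear (\<phi> j)" "\<And>j. j \<in> J \<Longrightarrow> \<phi> j (h j) = 1"
  shows "\<exists>x. \<forall>j\<in>J. \<phi> j x \<noteq> 0"
  using assms
proof (induction J rule: finite_induct)
  case (insert k J)
  then obtain x where x: "\<forall>j\<in>J. \<phi> j x \<noteq> 0" by auto
  show ?case
  proof (cases "\<phi> k x = 0")
    case False
    then show ?thesis using x by auto
  next
    case True
    \<comment> \<open>Moving in the direction \<open>h k\<close> makes the new form nonzero; \<open>r\<close> avoids the zeros of the others.\<close>
    obtain r :: real where r: "r \<notin> insert 0 ((\<lambda>j. - \<phi> j x / \<phi> j (h k)) ` J)"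
      using ex_new_if_finite[of "insert 0 ((\<lambda>j. - \<phi> j x / \<phi> j (h k)) ` J)"] insert.hyps
        infinite_UNIV_char_0 by blast
    have lin: "\<phi> j (x + r *\<^sub>R h k) = \<phi> j x + r * \<phi> j (h k)" if "j \<in> insert k J" for j
      using insert.prems(1)[OF that] by (simp add: linear_add linear_cmul)
    have "\<phi> j (x + r *\<^sub>R h k) \<noteq> 0" if "j \<in> insert k J" for j
    proof (cases "j = k")
      case True
      then show ?thesis using lin[OF that] \<open>\<phi> k x = 0\<close> insert.prems(2)[of k] r by auto
    next
      case False
      then have "j \<in> J" using that by simp
      then have "r \<noteq> - \<phi> j x / \<phi> j (h k)" "\<phi> j x \<noteq> 0" using r x by auto
      then show ?thesis
        using lin[OF that] by (cases "\<phi> j (h k) = 0") (auto simp: field_simps)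
    qed
    then show ?thesis by blast
  qed
qed simp

text \<open>
  The Gaussian factor replaces the constraint to a sphere in the maximisation. Its exponent changes
  along a complex line by the real part of a linear function and by a constant on circles, so it
  is compatible with the maximum modulus principle.
\<close>

definition weighted_product ::
    "'i set \<Rightarrow> ('i \<Rightarrow> nat) \<Rightarrow> ('i \<Rightarrow> 'h \<Rightarrow> real) \<Rightarrow> 'h \<times> 'h::real_inner \<Rightarrow> real" where
  "weighted_product J m \<phi> z =
     (\<Prod>j\<in>J. norm (complex_form (\<phi> j) z) ^ m j) * exp (- (norm z)\<^sup>2 / 2)"

lemma weighted_product_nonneg: "weighted_product J m \<phi> z \<ge> 0"
  by (simp add: weighted_product_def prod_nonneg)

lemma weighted_product_bounded:
  fixes \<phi> :: "'i \<Rightarrow> 'h::real_inner \<Rightarrow> real"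
  assumes "finite J" "\<And>j. j \<in> J \<Longrightarrow> bounded_linear (\<phi> j)"
  shows "bdd_above (range (weighted_product J m \<phi>))"
proof -
  have "\<exists>C. \<forall>z. norm (complex_form (\<phi> j) z) \<le> norm z * C" if "j \<in> J" for j
    using bounded_linear.bounded[OF bounded_linear_complex_form[OF assms(2)[OF that]]] .
  then obtain C where C: "\<And>j z. j \<in> J \<Longrightarrow> norm (complex_form (\<phi> j) z) \<le> norm z * C j"
    by metis
  define D where "D = (\<Sum>j\<in>J. \<bar>C j\<bar>)"
  define M where "M = (\<Sum>j\<in>J. m j)"
  have D0: "D \<ge> 0" by (simp add: D_def sum_nonneg)
  have le: "norm (complex_form (\<phi> j) z) \<le> D * norm z" if "j \<in> J" for j z
  proof -
    have "C j \<le> D"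
      using member_le_sum[of j J "\<lambda>j. \<bar>C j\<bar>"] assms(1) that by (auto simp: D_def)
    then have "norm z * C j \<le> norm z * D" by (intro mult_left_mono) auto
    then show ?thesis using C[OF that, of z] by (simp add: mult.commute)
  qed
  have "weighted_product J m \<phi> z \<le> fact M * exp (D\<^sup>2 / 2)" for z
  proof -
    \<comment> \<open>Exponential series for the power, then \<open>D * u - u\<^sup>2 / 2 \<le> D\<^sup>2 / 2\<close> in the exponent.\<close>
    let ?u = "D * norm z"
    have u0: "?u \<ge> 0" using D0 by simp
    have "(\<Prod>j\<in>J. norm (complex_form (\<phi> j) z) ^ m j) \<le> (\<Prod>j\<in>J. ?u ^ m j)"
      by (intro prod_mono) (auto intro!: power_mono le)
    also have "\<dots> = ?u ^ M" by (simp add: M_def power_sum)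
    also have "\<dots> \<le> fact M * exp ?u"
    proof -
      have "?u ^ M /\<^sub>R fact M \<le> (\<Sum>n. ?u ^ n /\<^sub>R fact n)"
        using sum_le_suminf[OF summable_exp_generic[of ?u], of "{M}"] u0 by auto
      then have "?u ^ M / fact M \<le> exp ?u"
        by (simp add: exp_def divide_inverse mult.commute)
      then show ?thesis by (simp add: field_simps)
    qed
    finally have "weighted_product J m \<phi> z \<le> fact M * exp ?u * exp (- (norm z)\<^sup>2 / 2)"
      unfolding weighted_product_def by (intro mult_right_mono) auto
    also have "\<dots> = fact M * exp (?u - (norm z)\<^sup>2 / 2)"
      by (simp add: mult_exp_exp mult.assoc)
    also have "\<dots> \<le> fact M * exp (D\<^sup>2 / 2)"
      using sum_squares_bound[of D "norm z"] by (intro mult_left_mono) auto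
    finally show ?thesis .
  qed
  then show ?thesis by (intro bdd_aboveI) auto
qed

text \<open>
  The variation is over the points \<open>z + \<zeta> h\<close> with \<open>norm \<zeta> = s\<close>. Every form is an affine function
  of \<open>\<zeta>\<close>, with slope 1 for the form \<open>k\<close>. The quotient of the Gaussians at \<open>z + \<zeta> h\<close> and \<open>z\<close> is the
  modulus of the exponential of a linear function of \<open>\<zeta>\<close>, times a constant that is at least
  \<open>exp (- s\<^sup>2 / 2)\<close>.
\<close>

lemma weighted_product_improve:
  fixes \<phi> :: "'i \<Rightarrow> 'h::real_inner \<Rightarrow> real"
  assumes J: "finite J" "k \<in> J" and lin: "\<And>j. j \<in> J \<Longrightarrow> linear (\<phi> j)"
    and h: "\<phi> k h = 1" "norm h \<le> 1" and s: "s > 0"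
  obtains z' where "weighted_product J m \<phi> z * s ^ m k
     \<le> norm (complex_form (\<phi> k) z) ^ m k * (weighted_product J m \<phi> z' * exp (s\<^sup>2 / 2))"
proof -
  \<comment> \<open>The sign makes \<open>Re (\<zeta> * c)\<close> the real inner product of \<open>z\<close> with \<open>\<zeta> h\<close>.\<close>
  define c where "c = Complex (fst z \<bullet> h) (- (snd z \<bullet> h))"
  define P where "P \<zeta> = (\<Prod>j\<in>J - {k}. (complex_form (\<phi> j) z + \<zeta> * of_real (\<phi> j h)) ^ m j)
      * exp (- (\<zeta> * c))" for \<zeta>
  define w where "w \<zeta> = z + (Re \<zeta> *\<^sub>R h, Im \<zeta> *\<^sub>R h)" for \<zeta>
  have form: "complex_form (\<phi> j) (w \<zeta>) = complex_form (\<phi> j) z + \<zeta> * of_real (\<phi> j h)"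
    if "j \<in> J" for j \<zeta>
    using lin[OF that]
    by (simp add: complex_form_def w_def complex_eq_iff linear_add linear_cmul)
  have norm_w: "(norm (w \<zeta>))\<^sup>2 = (norm z)\<^sup>2 + 2 * Re (\<zeta> * c) + (norm \<zeta>)\<^sup>2 * (norm h)\<^sup>2" for \<zeta>
    unfolding w_def c_def cmod_power2 power2_norm_eq_inner[where 'a="'h \<times> 'h"]
      power2_norm_eq_inner[where 'a='h]
    by (simp add: inner_prod_def algebra_simps inner_commute power2_eq_square)
  have "P holomorphic_on UNIV"
    unfolding P_def by (intro holomorphic_intros)
  then obtain \<zeta> where \<zeta>: "norm \<zeta> = s"
    "s ^ m k * norm (P 0) \<le> norm (complex_form (\<phi> k) z + \<zeta>) ^ m k * norm (P \<zeta>)"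
    using power_mult_entire_le_on_circle[OF _ s] by blast
  define Q where "Q \<zeta> = (\<Prod>j\<in>J - {k}. norm (complex_form (\<phi> j) (w \<zeta>)) ^ m j)" for \<zeta>
  have normP: "norm (P \<xi>) = Q \<xi> * exp (- Re (\<xi> * c))" for \<xi>
    by (simp add: P_def Q_def norm_mult norm_power form flip: prod_norm)
  have wp: "weighted_product J m \<phi> (w \<xi>)
      = norm (complex_form (\<phi> k) z + \<xi>) ^ m k * norm (P \<xi>)
        * (exp (- (norm z)\<^sup>2 / 2) * exp (- (norm \<xi>)\<^sup>2 * (norm h)\<^sup>2 / 2))" for \<xi>
  proof -
    have "weighted_product J m \<phi> (w \<xi>)
        = norm (complex_form (\<phi> k) (w \<xi>)) ^ m k * Q \<xi> * exp (- (norm (w \<xi>))\<^sup>2 / 2)"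
      using J by (simp add: weighted_product_def Q_def prod.remove)
    also have "exp (- (norm (w \<xi>))\<^sup>2 / 2) = exp (- Re (\<xi> * c))
        * (exp (- (norm z)\<^sup>2 / 2) * exp (- (norm \<xi>)\<^sup>2 * (norm h)\<^sup>2 / 2))"
      unfolding norm_w mult_exp_exp by (rule arg_cong[of _ _ exp]) (simp add: field_simps)
    finally show ?thesis
      using form[OF J(2), of \<xi>] h(1) by (simp add: normP mult_ac)
  qed
  let ?E = "exp (- (norm z)\<^sup>2 / 2)" and ?K = "norm (complex_form (\<phi> k) z) ^ m k"
  have "s\<^sup>2 * (norm h)\<^sup>2 \<le> s\<^sup>2 * 1"
    using h(2) by (intro mult_left_mono) (auto simp: power_le_one)
  then have sh: "1 \<le> exp (- s\<^sup>2 * (norm h)\<^sup>2 / 2) * exp (s\<^sup>2 / 2)"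
    by (simp add: mult_exp_exp)
  have w0: "w 0 = z" by (simp add: w_def zero_prod_def[symmetric])
  have "weighted_product J m \<phi> z * s ^ m k = ?K * ?E * (s ^ m k * norm (P 0))"
    using wp[of 0] by (simp add: w0 mult_ac)
  also have "\<dots> \<le> ?K * ?E * (norm (complex_form (\<phi> k) z + \<zeta>) ^ m k * norm (P \<zeta>))"
    by (intro mult_left_mono \<zeta>(2)) auto
  also have "\<dots> \<le> ?K * ?E * (norm (complex_form (\<phi> k) z + \<zeta>) ^ m k * norm (P \<zeta>))
      * (exp (- s\<^sup>2 * (norm h)\<^sup>2 / 2) * exp (s\<^sup>2 / 2))"
    using mult_left_mono[OF sh, of "?K * ?E * (norm (complex_form (\<phi> k) z + \<zeta>) ^ m k * norm (P \<zeta>))"]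
    by simp
  also have "\<dots> = ?K * (weighted_product J m \<phi> (w \<zeta>) * exp (s\<^sup>2 / 2))"
    by (simp add: wp \<zeta>(1) mult_ac)
  finally show ?thesis by (rule that)
qed

text \<open>
  At a point where the weighted product is within a factor \<open>exp (1 / 2)\<close> of its supremum, the
  radius \<open>s = sqrt (m k)\<close> in the preceding lemma shows that the form \<open>k\<close> is not much smaller than
  \<open>sqrt (m k)\<close>. The comparison with the point shrunk by \<open>sqrt 2\<close> bounds the norm, because the
  shrinking costs only a factor \<open>2\<close> to the half of the total weight but gains in the Gaussian.
  Working with a near-maximiser instead of a maximiser avoids any compactness.
\<close>

lemma complex_plank_integer_weights:
  fixes \<phi> :: "'i \<Rightarrow> 'h::real_inner \<Rightarrow> real" and m :: "'i \<Rightarrow> nat"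
  assumes J: "finite J" "J \<noteq> {}" and bl: "\<And>j. j \<in> J \<Longrightarrow> bounded_linear (\<phi> j)"
    and h: "\<And>j. j \<in> J \<Longrightarrow> \<phi> j (h j) = 1" "\<And>j. j \<in> J \<Longrightarrow> norm (h j) \<le> 1"
    and m: "\<And>j. j \<in> J \<Longrightarrow> m j \<ge> 1"
  obtains z where "(norm z)\<^sup>2 \<le> 4 * (\<Sum>j\<in>J. m j)"
    "\<And>j. j \<in> J \<Longrightarrow> sqrt (m j) \<le> exp 1 * norm (complex_form (\<phi> j) z)"
proof -
  let ?F = "weighted_product J m \<phi>"
  define M where "M = (\<Sum>j\<in>J. m j)"
  have M1: "M \<ge> 1"
  proof -
    obtain j where "j \<in> J" using J by auto
    then have "m j \<le> M" unfolding M_def using J by (intro member_le_sum) auto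
    then show ?thesis using m[OF \<open>j \<in> J\<close>] by simp
  qed
  define S where "S = (SUP z. ?F z)"
  have bdd: "bdd_above (range ?F)" by (rule weighted_product_bounded[OF J(1) bl])
  have leS: "?F z \<le> S" for z
    unfolding S_def by (intro cSUP_upper bdd) auto
  obtain x where x: "\<forall>j\<in>J. \<phi> j x \<noteq> 0"
    using linear_forms_common_nonzero[OF J(1), of \<phi> h] bl h(1) bounded_linear.linear by blast
  have "?F (x, 0) > 0"
    using x unfolding weighted_product_def
    by (intro mult_pos_pos prod_pos) (auto simp: complex_form_def complex_eq_iff)
  then have S0: "S > 0" using leS[of "(x, 0)"] by linarith
  have "S * exp (- 1 / 2) < S" using S0 by simp
  then obtain z where z: "S * exp (- 1 / 2) < ?F z"
    unfolding S_def using less_cSUP_iff[OF _ bdd] by auto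
  have near: "?F z' \<le> exp (1 / 2) * ?F z" for z'
  proof -
    have "S = exp (1 / 2) * (S * exp (- 1 / 2))" by (simp add: exp_minus)
    also have "\<dots> \<le> exp (1 / 2) * ?F z" using z by (intro mult_left_mono) auto
    finally show ?thesis using leS[of z'] by linarith
  qed
  have Fz: "?F z > 0" using z S0 by (smt (verit) exp_gt_zero mult_pos_pos)
  show ?thesis
  proof (rule that)
    show "sqrt (m k) \<le> exp 1 * norm (complex_form (\<phi> k) z)" if k: "k \<in> J" for k
    proof -
      let ?s = "sqrt (m k)" and ?y = "norm (complex_form (\<phi> k) z)"
      have s: "?s > 0" using m[OF k] by simp
      obtain z' where z': "?F z * ?s ^ m k \<le> ?y ^ m k * (?F z' * exp (?s\<^sup>2 / 2))"
        using weighted_product_improve[of J k \<phi> "h k" ?s m z] J(1) k bounded_linear.linear[OF bl]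
          h(1)[OF k] h(2)[OF k] s by blast
      also have "\<dots> \<le> ?y ^ m k * (exp (1 / 2) * ?F z * exp (?s\<^sup>2 / 2))"
        by (intro mult_left_mono mult_right_mono near) auto
      finally have "?F z * ?s ^ m k \<le> ?F z * (?y ^ m k * exp (1 / 2 + m k / 2))"
        by (simp add: mult_ac exp_add)
      then have "?s ^ m k \<le> ?y ^ m k * exp (1 / 2 + m k / 2)"
        using Fz by simp
      \<comment> \<open>The slack \<open>exp (1 / 2)\<close> of the near-maximiser is absorbed because \<open>m k \<ge> 1\<close>.\<close>
      also have "\<dots> \<le> ?y ^ m k * exp (m k)"
        using m[OF k] by (intro mult_left_mono) auto
      also have "\<dots> = (exp 1 * ?y) ^ m k"
        by (simp add: power_mult_distrib exp_of_nat_mult[of "m k" 1, simplified])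
      finally show ?thesis
        using m[OF k] power_mono_iff[of ?s "exp 1 * ?y" "m k"] by simp
    qed
    have scale: "?F ((1 / sqrt 2) *\<^sub>R z) = ?F z * exp ((norm z)\<^sup>2 / 4) / sqrt 2 ^ M"
    proof -
      have "norm (complex_form (\<phi> j) ((1 / sqrt 2) *\<^sub>R z)) = norm (complex_form (\<phi> j) z) / sqrt 2"
        if "j \<in> J" for j
        using linear_cmul[OF bounded_linear.linear[OF bounded_linear_complex_form[OF bl[OF that]]]]
        by simp
      then have "(\<Prod>j\<in>J. norm (complex_form (\<phi> j) ((1 / sqrt 2) *\<^sub>R z)) ^ m j)
          = (\<Prod>j\<in>J. norm (complex_form (\<phi> j) z) ^ m j) / sqrt 2 ^ M"
        by (simp add: power_divide prod_dividef M_def power_sum)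
      moreover have "exp (- (norm ((1 / sqrt 2) *\<^sub>R z))\<^sup>2 / 2)
          = exp (- (norm z)\<^sup>2 / 2) * exp ((norm z)\<^sup>2 / 4)"
        unfolding mult_exp_exp
        by (rule arg_cong[of _ _ exp]) (simp add: power_mult_distrib power_divide field_simps)
      ultimately show ?thesis by (simp add: weighted_product_def)
    qed
    have "?F z * exp ((norm z)\<^sup>2 / 4) \<le> ?F z * (exp (1 / 2) * sqrt 2 ^ M)"
      using near[of "(1 / sqrt 2) *\<^sub>R z"] unfolding scale by (simp add: field_simps)
    then have "exp ((norm z)\<^sup>2 / 4) \<le> exp (1 / 2) * sqrt 2 ^ M" using Fz by simp
    also have "sqrt 2 ^ M \<le> exp (1 / 2) ^ M"
    proof (intro power_mono)
      have "sqrt 2 \<le> sqrt (exp 1)"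
        using exp_ge_add_one_self[of 1] by (intro real_sqrt_le_mono) auto
      also have "sqrt (exp 1) = exp (1 / 2)"
        by (intro real_sqrt_unique) (auto simp: power2_eq_square mult_exp_exp)
      finally show "sqrt 2 \<le> exp (1 / 2 :: real)" .
    qed simp
    finally have "exp ((norm z)\<^sup>2 / 4) \<le> exp (1 / 2 + M / 2)"
      by (simp add: exp_add exp_of_nat_mult[of M "1 / 2", simplified])
    then show "(norm z)\<^sup>2 \<le> 4 * (\<Sum>j\<in>J. m j)"
      using M1 by (simp add: M_def[symmetric])
  qed
qed

section \<open>A complex plank theorem\<close>

text \<open>
  The numbers \<open>(t j)\<^sup>2\<close> are rounded up to multiples of \<open>1 / N\<close>. For large \<open>N\<close> this at most doubles
  their sum.
\<close>

lemma complex_plank_finite: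
  fixes \<phi> :: "'i \<Rightarrow> 'h::real_inner \<Rightarrow> real" and t :: "'i \<Rightarrow> real"
  assumes J: "finite J" and bl: "\<And>j. j \<in> J \<Longrightarrow> bounded_linear (\<phi> j)"
    and h: "\<And>j. j \<in> J \<Longrightarrow> \<phi> j (h j) = 1" "\<And>j. j \<in> J \<Longrightarrow> norm (h j) \<le> 1"
    and t: "\<And>j. j \<in> J \<Longrightarrow> t j > 0"
  obtains z where "(norm z)\<^sup>2 \<le> 8 * (exp 1)\<^sup>2 * (\<Sum>j\<in>J. (t j)\<^sup>2)"
    "\<And>j. j \<in> J \<Longrightarrow> t j \<le> norm (complex_form (\<phi> j) z)"
proof (cases "J = {}")
  case True
  then show ?thesis using that[of 0] by simp
next
  case False
  define T where "T = (\<Sum>j\<in>J. (t j)\<^sup>2)"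
  have T: "T > 0" unfolding T_def using J False by (intro sum_pos zero_less_power t) auto
  obtain N :: nat where "card J / T < N" using reals_Archimedean2 by blast
  then have N: "card J \<le> N * T" "N > 0"
    using T by (auto simp: field_simps intro: Nat.gr0I)
  define m where "m j = nat \<lceil>N * (t j)\<^sup>2\<rceil>" for j
  have Nt: "N * (t j)\<^sup>2 > 0" if "j \<in> J" for j
    using t[OF that] N by simp
  have m: "N * (t j)\<^sup>2 \<le> m j" "m j \<le> N * (t j)\<^sup>2 + 1" for j
    unfolding m_def by (auto simp: of_nat_nat)
  have m1: "m j \<ge> 1" if "j \<in> J" for j
    using m(1)[of j] Nt[OF that] by linarith
  obtain z where z: "(norm z)\<^sup>2 \<le> 4 * (\<Sum>j\<in>J. m j)"
    "\<And>j. j \<in> J \<Longrightarrow> sqrt (m j) \<le> exp 1 * norm (complex_form (\<phi> j) z)"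
    using complex_plank_integer_weights[of J \<phi> h m] J False bl h m1 by auto
  have "real (\<Sum>j\<in>J. m j) \<le> (\<Sum>j\<in>J. N * (t j)\<^sup>2 + 1)"
    unfolding of_nat_sum by (intro sum_mono m)
  also have "\<dots> = N * T + card J"
    by (simp add: sum.distrib T_def sum_distrib_left)
  finally have M: "real (\<Sum>j\<in>J. m j) \<le> 2 * (N * T)" using N by linarith
  define r where "r = exp 1 / sqrt N"
  have r: "r > 0" "r\<^sup>2 = (exp 1)\<^sup>2 / N" using N by (auto simp: r_def power_divide)
  show ?thesis
  proof (rule that[of "r *\<^sub>R z"])
    have "(norm (r *\<^sub>R z))\<^sup>2 = r\<^sup>2 * (norm z)\<^sup>2" by (simp add: power_mult_distrib)
    also have "\<dots> \<le> r\<^sup>2 * (8 * (N * T))" using z(1) M by (intro mult_left_mono) auto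
    also have "\<dots> = 8 * (exp 1)\<^sup>2 * T" using N by (simp add: r)
    finally show "(norm (r *\<^sub>R z))\<^sup>2 \<le> 8 * (exp 1)\<^sup>2 * (\<Sum>j\<in>J. (t j)\<^sup>2)" by (simp add: T_def)
    show "t j \<le> norm (complex_form (\<phi> j) (r *\<^sub>R z))" if j: "j \<in> J" for j
    proof -
      have "sqrt N * t j = sqrt (N * (t j)\<^sup>2)" using t[OF j] by (simp add: real_sqrt_mult)
      also have "\<dots> \<le> sqrt (m j)" by (intro real_sqrt_le_mono m)
      also have "\<dots> \<le> exp 1 * norm (complex_form (\<phi> j) z)" by (rule z(2)[OF j])
      finally have "t j \<le> r * norm (complex_form (\<phi> j) z)"
        using N by (simp add: r_def field_simps)
      then show ?thesis
        using linear_cmul[OF bounded_linear.linear[OF bounded_linear_complex_form[OF bl[OF j]]]] r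
        by simp
    qed
  qed
qed

text \<open>
  Almost minimal vectors of the sets form a Cauchy sequence. Indeed, the midpoint of two of them
  lies in the larger one of the two sets, so the parallelogram law bounds their distance by the
  increment of the minimal norms, and these increase to a finite limit.
\<close>

lemma nested_convex_sets_nonempty:
  fixes C :: "nat \<Rightarrow> 'a::{real_inner, banach} set"
  assumes cl: "\<And>n. closed (C n)" and conv: "\<And>n. convex (C n)" and dec: "decseq C"
    and ne: "\<And>n. C n \<noteq> {}" and bd: "bounded (C 0)"
  shows "(\<Inter>n. C n) \<noteq> {}"
proof -
  define q where "q n = (INF z\<in>C n. (norm z)\<^sup>2)" for n
  have below: "bdd_below ((\<lambda>z. (norm z)\<^sup>2) ` C n)" for n
    by (rule bdd_belowI[of _ 0]) auto
  have q_le: "q n \<le> (norm z)\<^sup>2" if "z \<in> C n" for n z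
    unfolding q_def by (rule cINF_lower[OF below that])
  have mono: "C n \<subseteq> C m" if "m \<le> n" for m n
    using decseqD[OF dec that] .
  obtain R where R: "\<And>z. z \<in> C 0 \<Longrightarrow> norm z \<le> R"
    using bd by (auto simp: bounded_iff)
  have "incseq q"
  proof (rule monoI)
    fix n m :: nat assume "n \<le> m"
    then show "q n \<le> q m"
      unfolding q_def by (intro cINF_superset_mono below ne mono) auto
  qed
  moreover have "q n \<le> R\<^sup>2" for n
  proof -
    obtain z where "z \<in> C n" using ne[of n] by blast
    then show ?thesis
      using q_le[of z n] R[of z] mono[of 0 n] power_mono[of "norm z" R 2] by force
  qed
  ultimately obtain L where L: "q \<longlonglongrightarrow> L" "\<And>n. q n \<le> L"
    using incseq_convergent[of q "R\<^sup>2"] by blast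
  have "\<exists>z\<in>C n. (norm z)\<^sup>2 < q n + 1 / Suc n" for n
    using cInf_lessD[of "(\<lambda>z. (norm z)\<^sup>2) ` C n" "q n + 1 / Suc n"] ne[of n]
    by (auto simp: q_def)
  then obtain z where z: "\<And>n. z n \<in> C n" "\<And>n. (norm (z n))\<^sup>2 < q n + 1 / Suc n"
    by metis
  have close: "(norm (z m - z n))\<^sup>2 \<le> 2 * (L - q n) + 4 / Suc n" if "n \<le> m" for m n
  proof -
    have "(1 / 2) *\<^sub>R z m + (1 / 2) *\<^sub>R z n \<in> C n"
      using convexD[OF conv, of "z m" n "z n" "1/2" "1/2"] z(1) mono[OF that] by auto
    then have "q n \<le> (norm ((1 / 2) *\<^sub>R (z m + z n)))\<^sup>2"
      using q_le by (simp add: scaleR_add_right)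
    then have "4 * q n \<le> (norm (z m + z n))\<^sup>2"
      by (simp add: power_divide)
    moreover have "(norm (z m + z n))\<^sup>2 + (norm (z m - z n))\<^sup>2
        = 2 * (norm (z m))\<^sup>2 + 2 * (norm (z n))\<^sup>2"
      by (simp add: power2_norm_eq_inner inner_simps)
    moreover have "1 / Suc m \<le> 1 / real (Suc n)" using that by (simp add: field_simps)
    ultimately show ?thesis
      using z(2)[of m] z(2)[of n] L(2)[of m] by simp
  qed
  have "(\<lambda>n. 2 * (L - q n) + 4 * (1 / Suc n)) \<longlonglongrightarrow> 2 * (L - L) + 4 * 0"
    by (intro tendsto_intros L LIMSEQ_Suc[OF lim_1_over_n])
  then have small: "(\<lambda>n. 2 * (L - q n) + 4 / Suc n) \<longlonglongrightarrow> 0" by simp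
  have "Cauchy z"
  proof (rule CauchyI')
    fix e :: real assume e: "e > 0"
    then have "\<forall>\<^sub>F n in sequentially. 2 * (L - q n) + 4 / Suc n < e\<^sup>2"
      by (intro order_tendstoD(2)[OF small]) simp
    then obtain N where N: "\<And>n. n \<ge> N \<Longrightarrow> 2 * (L - q n) + 4 / Suc n < e\<^sup>2"
      by (auto simp: eventually_sequentially)
    have "norm (z n - z m) < e" if "n \<ge> N" "n < m" for m n
    proof (rule power2_less_imp_less)
      show "(norm (z n - z m))\<^sup>2 < e\<^sup>2"
        using close[of n m] N[of n] that by (simp add: norm_minus_commute)
    qed (use e in simp)
    then show "\<exists>M. \<forall>m\<ge>M. \<forall>n>m. dist (z m) (z n) < e"
      by (auto simp: dist_norm)
  qed
  then obtain y where y: "z \<longlonglongrightarrow> y" using Cauchy_convergent convergent_def by blast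
  have "y \<in> C n" for n
  proof (rule closed_sequentially[OF cl])
    show "z (k + n) \<in> C n" for k using z(1)[of "k + n"] mono[of n "k + n"] by auto
    show "(\<lambda>k. z (k + n)) \<longlonglongrightarrow> y" using LIMSEQ_ignore_initial_segment[OF y] .
  qed
  then show ?thesis by blast
qed

text \<open>
  A diagonal argument gives a subsequence along which all the maps converge. The limit values are
  attained at a point of the ball, since the sets on which finitely many of the maps are close to
  their limits are closed, convex and nested.
\<close>

lemma bounded_sequence_weak_cluster_point:
  fixes \<Phi> :: "nat \<Rightarrow> 'a::{real_inner, banach} \<Rightarrow> 'b::{real_normed_vector, heine_borel}"
  assumes bl: "\<And>k. bounded_linear (\<Phi> k)" and B: "\<And>k x. norm (\<Phi> k x) \<le> B * norm x"
    and R: "\<And>n::nat. norm (z n) \<le> R"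
  obtains x and r :: "nat \<Rightarrow> nat" where "norm x \<le> R" "strict_mono r" "\<And>k. (\<lambda>n. \<Phi> k (z (r n))) \<longlonglongrightarrow> \<Phi> k x"
proof -
  have "norm (\<Phi> k (z n)) \<le> \<bar>B\<bar> * R" for k n
  proof -
    have "norm (\<Phi> k (z n)) \<le> \<bar>B\<bar> * norm (z n)"
      using B[of k "z n"] mult_right_mono[of B "\<bar>B\<bar>" "norm (z n)"] by force
    also have "\<dots> \<le> \<bar>B\<bar> * R" using R by (intro mult_left_mono) auto
    finally show ?thesis .
  qed
  then obtain r where r: "strict_mono r" "\<And>k. \<exists>l. (\<lambda>n. \<Phi> k (z (r n))) \<longlonglongrightarrow> l"
    using function_convergent_subsequence[of "UNIV :: nat set" "\<lambda>n k. \<Phi> k (z n)" "\<bar>B\<bar> * R"]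
    by (metis UNIV_I countableI_type)
  then obtain c where c: "\<And>k. (\<lambda>n. \<Phi> k (z (r n))) \<longlonglongrightarrow> c k" by metis
  define C where "C n = cball 0 R \<inter> (\<Inter>k\<in>{..n}. \<Phi> k -` cball (c k) (1 / Suc n))" for n
  have "(\<Inter>n. C n) \<noteq> {}"
  proof (rule nested_convex_sets_nonempty)
    show "closed (C n)" for n
      unfolding C_def
      by (intro closed_Int closed_cball closed_INT ballI closed_vimage
          linear_continuous_on bl)
    show "convex (C n)" for n
      unfolding C_def
      by (intro convex_Int convex_cball convex_INT convex_linear_vimage
          bounded_linear.linear[OF bl])
    show "decseq C"
    proof (rule decseq_SucI)
      fix n
      have "1 / real (Suc (Suc n)) \<le> 1 / Suc n" by (simp add: field_simps)
      then have "\<Phi> k -` cball (c k) (1 / Suc (Suc n)) \<subseteq> \<Phi> k -` cball (c k) (1 / Suc n)" for k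
        by (intro vimage_mono subset_cball)
      then show "C (Suc n) \<subseteq> C n"
        unfolding C_def by (intro Int_mono order_refl INT_anti_mono) auto
    qed
    show "bounded (C 0)"
      unfolding C_def by (intro bounded_Int disjI1 bounded_cball)
    show "C n \<noteq> {}" for n
    proof -
      have "\<forall>\<^sub>F i in sequentially. \<forall>k\<in>{..n}. dist (\<Phi> k (z (r i))) (c k) < 1 / Suc n"
        by (intro eventually_ball_finite ballI tendstoD[OF c]) auto
      then obtain i where "\<forall>k\<in>{..n}. dist (\<Phi> k (z (r i))) (c k) < 1 / Suc n"
        by (auto simp: eventually_sequentially)
      then have "z (r i) \<in> C n"
        using R by (auto simp: C_def dist_commute less_imp_le)
      then show ?thesis by blast
    qed
  qed
  then obtain x where x: "\<And>n. x \<in> C n" by blast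
  have "\<Phi> k x = c k" for k
  proof -
    have "dist (c k) (\<Phi> k x) \<le> 1 / Suc n" if "n \<ge> k" for n
      using x[of n] that by (auto simp: C_def)
    moreover have "(\<lambda>n. 1 / real (Suc n)) \<longlonglongrightarrow> 0" by (rule LIMSEQ_Suc[OF lim_1_over_n])
    ultimately have "dist (c k) (\<Phi> k x) \<le> 0" by (intro LIMSEQ_le_const) auto
    then show ?thesis by simp
  qed
  then show ?thesis using that[of x r] x[of 0] r c by (auto simp: C_def)
qed

text \<open>
  Ball's theorem has the constant 1 in place of \<open>8 * (exp 1)\<^sup>2\<close> and assumes unit vectors that
  represent the forms. Here any \<open>h j\<close> in the unit ball with \<open>\<phi> j (h j) = 1\<close> will do.
\<close>

lemma complex_plank:
  fixes \<phi> :: "nat \<Rightarrow> 'h::{real_inner, banach} \<Rightarrow> real" and t :: "nat \<Rightarrow> real"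
  assumes bl: "\<And>j. bounded_linear (\<phi> j)" and B: "\<And>j x. \<bar>\<phi> j x\<bar> \<le> B * norm x"
    and h: "\<And>j. \<phi> j (h j) = 1" "\<And>j. norm (h j) \<le> 1"
    and t: "\<And>j. j \<in> I \<Longrightarrow> t j > 0"
    and T: "\<And>J. finite J \<Longrightarrow> J \<subseteq> I \<Longrightarrow> (\<Sum>j\<in>J. (t j)\<^sup>2) \<le> T"
  obtains z where "(norm z)\<^sup>2 \<le> 8 * (exp 1)\<^sup>2 * T"
    "\<And>j. j \<in> I \<Longrightarrow> t j \<le> norm (complex_form (\<phi> j) z)"
proof -
  define R where "R = sqrt (8 * (exp 1)\<^sup>2 * T)"
  have "T \<ge> 0" using T[of "{}"] by simp
  then have R: "R\<^sup>2 = 8 * (exp 1)\<^sup>2 * T" "R \<ge> 0" by (auto simp: R_def)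
  have "\<exists>z. norm z \<le> R \<and> (\<forall>j\<in>I \<inter> {..n}. t j \<le> norm (complex_form (\<phi> j) z))" for n
  proof -
    obtain z where z: "(norm z)\<^sup>2 \<le> 8 * (exp 1)\<^sup>2 * (\<Sum>j\<in>I \<inter> {..n}. (t j)\<^sup>2)"
      "\<And>j. j \<in> I \<inter> {..n} \<Longrightarrow> t j \<le> norm (complex_form (\<phi> j) z)"
      using complex_plank_finite[of "I \<inter> {..n}" \<phi> h t] bl h t by auto
    have "8 * (exp 1)\<^sup>2 * (\<Sum>j\<in>I \<inter> {..n}. (t j)\<^sup>2) \<le> R\<^sup>2"
      unfolding R by (intro mult_left_mono T) auto
    then have "(norm z)\<^sup>2 \<le> R\<^sup>2" using z(1) by (rule order_trans[rotated])
    then have "norm z \<le> R" using R(2) by (rule power2_le_imp_le)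
    then show ?thesis using z(2) by blast
  qed
  then obtain z where "\<forall>n. norm (z n) \<le> R \<and> (\<forall>j\<in>I \<inter> {..n}. t j \<le> norm (complex_form (\<phi> j) (z n)))"
    by metis
  then have z: "\<And>n. norm (z n) \<le> R"
    "\<And>n j. j \<in> I \<Longrightarrow> j \<le> n \<Longrightarrow> t j \<le> norm (complex_form (\<phi> j) (z n))"
    by auto
  obtain x r where x: "norm x \<le> R" "strict_mono r"
    "\<And>k. (\<lambda>n. complex_form (\<phi> k) (z (r n))) \<longlonglongrightarrow> complex_form (\<phi> k) x"
    using bounded_sequence_weak_cluster_point[of "\<lambda>k. complex_form (\<phi> k)" "\<bar>B\<bar>" z R]
      bounded_linear_complex_form[OF bl] norm_complex_form_le[of "\<phi> _", OF B] z(1) by blast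
  show ?thesis
  proof (rule that)
    show "(norm x)\<^sup>2 \<le> 8 * (exp 1)\<^sup>2 * T"
      using x(1) R power_mono[of "norm x" R 2] by simp
    show "t j \<le> norm (complex_form (\<phi> j) x)" if "j \<in> I" for j
    proof (rule LIMSEQ_le_const[OF tendsto_norm[OF x(3)]])
      show "\<exists>N. \<forall>n\<ge>N. t j \<le> norm (complex_form (\<phi> j) (z (r n)))"
        using z(2)[OF that] seq_suble[OF x(2)] by (meson order_trans)
    qed
  qed
qed

section \<open>Filter bases have admissible norms\<close>

lemma partial_sum_tendsto:
  assumes "filter_basis F u"
  shows "((\<lambda>n. partial_sum F u n x) \<longlongrightarrow> x) F"
  using theI'[OF assms[unfolded filter_basis_def, rule_format, of x]]
  by (simp add: partial_sum_def coordinate_def)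

lemma coordinate_eqI:
  assumes "filter_basis F u" "((\<lambda>n. \<Sum>k\<le>n. c k *\<^sub>R u k) \<longlongrightarrow> x) F"
  shows "coordinate F u k x = c k"
proof -
  have "(THE c. ((\<lambda>n. \<Sum>k\<le>n. c k *\<^sub>R u k) \<longlongrightarrow> x) F) = c"
    by (rule the1_equality) (use assms in \<open>auto simp: filter_basis_def\<close>)
  then show ?thesis by (simp add: coordinate_def)
qed

lemma linear_coordinate:
  assumes "filter_basis F u"
  shows "linear (coordinate F u k)"
proof (rule linearI)
  fix x y r
  have conv: "((\<lambda>n. \<Sum>k\<le>n. coordinate F u k x *\<^sub>R u k) \<longlongrightarrow> x) F" for x
    using partial_sum_tendsto[OF assms] by (simp add: partial_sum_def)
  have "((\<lambda>n. \<Sum>k\<le>n. (coordinate F u k x + coordinate F u k y) *\<^sub>R u k) \<longlongrightarrow> x + y) F"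
    using tendsto_add[OF conv[of x] conv[of y]] by (simp add: sum.distrib scaleR_add_left)
  then show "coordinate F u k (x + y) = coordinate F u k x + coordinate F u k y"
    by (rule coordinate_eqI[OF assms])
  have "((\<lambda>n. \<Sum>k\<le>n. (r * coordinate F u k x) *\<^sub>R u k) \<longlongrightarrow> r *\<^sub>R x) F"
    using tendsto_scaleR[OF tendsto_const conv[of x]] by (simp add: scaleR_sum_right)
  then show "coordinate F u k (r *\<^sub>R x) = r *\<^sub>R coordinate F u k x"
    unfolding real_scaleR_def by (rule coordinate_eqI[OF assms])
qed

lemma linear_continuous_at_0_imp_bounded_linear:
  fixes f :: "'a::real_normed_vector \<Rightarrow> 'b::real_normed_vector"
  assumes lin: "linear f" and cont: "isCont f 0"
  shows "bounded_linear f"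
proof -
  have "f 0 = 0" using lin by (rule linear_0)
  then obtain d where d: "d > 0" "\<And>x. norm x < d \<Longrightarrow> norm (f x) < 1"
    using cont unfolding continuous_at_eps_delta by (auto dest!: spec[of _ 1] simp: dist_norm)
  have "norm (f x) \<le> norm x * (2 / d)" for x
  proof (cases "x = 0")
    case False
    define c where "c = d / (2 * norm x)"
    have c: "c > 0" using False d(1) by (simp add: c_def)
    have "norm (c *\<^sub>R x) < d" using False d(1) by (simp add: c_def)
    then have "c * norm (f x) < 1"
      using d(2)[of "c *\<^sub>R x"] c by (simp add: linear_cmul[OF lin])
    then show ?thesis using False d(1) by (simp add: c_def field_simps)
  qed (simp add: \<open>f 0 = 0\<close>)
  then show ?thesis
    using lin unfolding bounded_linear_def bounded_linear_axioms_def by blast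
qed

lemma bounded_linear_partial_sum:
  assumes "filter_basis F u" "\<And>k. continuous_on UNIV (coordinate F u k)"
  shows "bounded_linear (partial_sum F u n)"
proof -
  have "bounded_linear (coordinate F u k)" for k
    using assms(2)[of k] linear_coordinate[OF assms(1), of k]
    by (intro linear_continuous_at_0_imp_bounded_linear)
      (auto simp: continuous_on_eq_continuous_at)
  then show ?thesis
    unfolding partial_sum_def[abs_def]
    by (intro bounded_linear_sum bounded_linear_scaleR_const)
qed

text \<open>
  An operator \<open>S n\<close> is large at a vector when its component in the direction of \<open>S n (h n)\<close> is
  large, where \<open>h n\<close> is a unit vector at which \<open>S n\<close> almost attains its norm. This reduces the
  claim to linear forms.
\<close>

lemma operators_large_at_common_point:
  fixes S :: "nat \<Rightarrow> 'h::{real_inner, banach} \<Rightarrow> 'k::real_inner" and a :: "nat \<Rightarrow> real"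
  assumes bl: "\<And>n. bounded_linear (S n)" and norm: "\<And>n. onorm (S n) = a n"
    and a: "\<And>n. a n > 0" and I: "\<And>J. finite J \<Longrightarrow> J \<subseteq> I \<Longrightarrow> (\<Sum>n\<in>J. 1 / (a n)\<^sup>2) \<le> T"
    and K: "K > 0"
  obtains x y where "(norm x)\<^sup>2 + (norm y)\<^sup>2 \<le> 32 * (exp 1)\<^sup>2 * K\<^sup>2 * T"
    "\<And>n. n \<in> I \<Longrightarrow> K\<^sup>2 \<le> (norm (S n x))\<^sup>2 + (norm (S n y))\<^sup>2"
proof -
  have "\<exists>h. norm h = 1 \<and> a n / 2 \<le> norm (S n h)" for n
  proof -
    interpret S: bounded_linear "S n" by (rule bl)
    have "\<not> (\<forall>x. norm (S n x) \<le> a n / 2 * norm x)"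
      using onorm_bound[of "a n / 2" "S n"] a[of n] norm[of n] by force
    then obtain x where x: "a n / 2 * norm x < norm (S n x)" by (meson not_le)
    then have "x \<noteq> 0" using S.zero by auto
    then show ?thesis
      using x by (intro exI[of _ "x /\<^sub>R norm x"]) (simp add: S.scaleR field_simps)
  qed
  then obtain h where h: "\<And>n. norm (h n) = 1" "\<And>n. a n / 2 \<le> norm (S n (h n))" by metis
  have Sh: "norm (S n (h n)) > 0" for n using h(2)[of n] a[of n] by linarith
  define \<phi> where "\<phi> n x = (S n x \<bullet> S n (h n)) / (norm (S n (h n)))\<^sup>2" for n x
  have \<phi>_le: "a n * \<bar>\<phi> n x\<bar> \<le> 2 * norm (S n x)" for n x
  proof -
    have "\<bar>\<phi> n x\<bar> \<le> norm (S n x) * norm (S n (h n)) / (norm (S n (h n)))\<^sup>2"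
      unfolding \<phi>_def abs_divide by (intro divide_mono Cauchy_Schwarz_ineq2) (use Sh in auto)
    then have "\<bar>\<phi> n x\<bar> * norm (S n (h n)) \<le> norm (S n x)"
      using Sh[of n] by (simp add: power2_eq_square field_simps)
    moreover have "\<bar>\<phi> n x\<bar> * (a n / 2) \<le> \<bar>\<phi> n x\<bar> * norm (S n (h n))"
      by (intro mult_left_mono h) auto
    ultimately show ?thesis by (simp add: mult.commute)
  qed
  obtain z where z: "(norm z)\<^sup>2 \<le> 8 * (exp 1)\<^sup>2 * (4 * K\<^sup>2 * T)"
    "\<And>n. n \<in> I \<Longrightarrow> 2 * K / a n \<le> norm (complex_form (\<phi> n) z)"
  proof (rule complex_plank[of \<phi> 2 h I "\<lambda>n. 2 * K / a n" "4 * K\<^sup>2 * T"])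
    show "bounded_linear (\<phi> n)" for n
      unfolding \<phi>_def[abs_def] divide_inverse
      by (intro bounded_linear_mult_const bounded_linear_compose[OF bounded_linear_inner_left bl])
    show "\<bar>\<phi> n x\<bar> \<le> 2 * norm x" for n x
    proof -
      have "a n * \<bar>\<phi> n x\<bar> \<le> a n * (2 * norm x)"
        using \<phi>_le[of n x] onorm[OF bl, of n x] norm[of n] by (simp add: mult_ac)
      then show ?thesis using a[of n] by simp
    qed
    show "\<phi> n (h n) = 1" for n using Sh[of n] by (simp add: \<phi>_def power2_norm_eq_inner)
    show "2 * K / a n > 0" if "n \<in> I" for n using K a by simp
    show "(\<Sum>n\<in>J. (2 * K / a n)\<^sup>2) \<le> 4 * K\<^sup>2 * T" if "finite J" "J \<subseteq> I" for J
    proof -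
      have "(\<Sum>n\<in>J. (2 * K / a n)\<^sup>2) = 4 * K\<^sup>2 * (\<Sum>n\<in>J. 1 / (a n)\<^sup>2)"
        by (simp add: sum_distrib_left power_divide power_mult_distrib)
      also have "\<dots> \<le> 4 * K\<^sup>2 * T" using I[OF that] by (intro mult_left_mono) auto
      finally show ?thesis .
    qed
  qed (use h in auto)
  show ?thesis
  proof (rule that)
    show "(norm (fst z))\<^sup>2 + (norm (snd z))\<^sup>2 \<le> 32 * (exp 1)\<^sup>2 * K\<^sup>2 * T"
      using z(1) by (simp add: norm_prod_def mult_ac)
    show "K\<^sup>2 \<le> (norm (S n (fst z)))\<^sup>2 + (norm (S n (snd z)))\<^sup>2" if n: "n \<in> I" for n
    proof -
      have sq: "(a n * \<phi> n x)\<^sup>2 \<le> 4 * (norm (S n x))\<^sup>2" for x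
        using power_mono[OF \<phi>_le[of n x], of 2] a[of n] by (simp add: power_mult_distrib)
      have "2 * K \<le> a n * norm (complex_form (\<phi> n) z)"
        using z(2)[OF n] a[of n] by (simp add: field_simps)
      then have "(2 * K)\<^sup>2 \<le> (a n * norm (complex_form (\<phi> n) z))\<^sup>2"
        using K by (intro power_mono) auto
      also have "\<dots> = (a n * \<phi> n (fst z))\<^sup>2 + (a n * \<phi> n (snd z))\<^sup>2"
        by (simp add: complex_form_def power_mult_distrib cmod_power2 algebra_simps)
      also have "\<dots> \<le> 4 * (norm (S n (fst z)))\<^sup>2 + 4 * (norm (S n (snd z)))\<^sup>2"
        by (intro add_mono sq)
      finally show ?thesis by (simp add: power_mult_distrib)
    qed
  qed
qed

lemma filter_basis_imp_admissible:
  fixes u :: "nat \<Rightarrow> 'h::{real_inner, banach}"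
  assumes free: "free_filter F" and a: "\<And>n. a n > 1"
    and basis: "hilbert_filter_basis_with_norms F a u"
  shows "admissible F 2 a"
  unfolding admissible_def
proof (intro allI impI, rule ccontr)
  fix I assume I: "stationary F I" and fin: "(\<Sum>\<^sub>\<infinity>n\<in>I. ennreal (a n powr - 2)) \<noteq> \<infinity>"
  have a0: "a n > 0" for n using a[of n] by linarith
  have powr: "a n powr - 2 = 1 / (a n)\<^sup>2" for n
    using a0[of n] by (simp add: powr_minus divide_inverse)
  define b where "b n = (if n \<in> I then 1 / (a n)\<^sup>2 else 0)" for n
  obtain C where C: "(\<Sum>\<^sub>\<infinity>n\<in>I. ennreal (a n powr - 2)) = ennreal C" "C \<ge> 0"
    using fin by (cases "\<Sum>\<^sub>\<infinity>n\<in>I. ennreal (a n powr - 2)") auto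
  have "summable b"
  proof (rule summableI_nonneg_bounded)
    show "(\<Sum>n<N. b n) \<le> C" for N
    proof -
      have "(\<Sum>n<N. b n) = (\<Sum>n\<in>{..<N} \<inter> I. a n powr - 2)"
        by (simp add: b_def powr sum.inter_restrict)
      moreover have "(\<Sum>n\<in>{..<N} \<inter> I. ennreal (a n powr - 2)) \<le> ennreal C"
        unfolding C(1)[symmetric]
        by (subst nonneg_infsum_complete) (auto intro!: SUP_upper)
      ultimately show ?thesis using C(2) by (simp add: sum_ennreal)
    qed
  qed (simp add: b_def)
  \<comment> \<open>This \<open>\<delta>\<close> makes the vectors \<open>x\<close> and \<open>y\<close> below satisfy \<open>(norm x)\<^sup>2 + (norm y)\<^sup>2 \<le> 1\<close>, while their
    partial sums with index in the tail of \<open>I\<close> have squared norms with sum at least 4.\<close>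
  define \<delta> :: real where "\<delta> = 1 / (32 * (exp 1)\<^sup>2 * 2\<^sup>2)"
  have \<delta>: "\<delta> > 0" by (simp add: \<delta>_def)
  obtain N where N: "norm (\<Sum>i. b (i + N)) < \<delta>"
    using suminf_exist_split[OF \<delta> \<open>summable b\<close>] by blast
  have tail: "(\<Sum>n\<in>J. 1 / (a n)\<^sup>2) \<le> \<delta>" if J: "finite J" "J \<subseteq> I \<inter> {N..}" for J
  proof -
    have "(\<Sum>n\<in>J. 1 / (a n)\<^sup>2) = (\<Sum>n\<in>J. b n)"
      using J by (intro sum.cong) (auto simp: b_def)
    also have "\<dots> = (\<Sum>i\<in>(\<lambda>n. n - N) ` J. b (i + N))"
      using J by (intro sum.reindex_bij_witness[of _ "\<lambda>i. i + N" "\<lambda>n. n - N"]) force+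
    also have "\<dots> \<le> (\<Sum>i. b (i + N))"
    proof (rule sum_le_suminf)
      show "summable (\<lambda>i. b (i + N))"
        by (rule summable_ignore_initial_segment[OF \<open>summable b\<close>])
    qed (use J in \<open>auto simp: b_def\<close>)
    also have "\<dots> \<le> \<delta>" using N by simp
    finally show ?thesis .
  qed
  have fb: "filter_basis F u" "\<And>k. continuous_on UNIV (coordinate F u k)"
    and norm: "\<And>n. onorm (partial_sum F u n) = a n"
    using basis by (auto simp: hilbert_filter_basis_with_norms_def)
  obtain x y where xy: "(norm x)\<^sup>2 + (norm y)\<^sup>2 \<le> 32 * (exp 1)\<^sup>2 * 2\<^sup>2 * \<delta>"
    "\<And>n. n \<in> I \<inter> {N..} \<Longrightarrow> 2\<^sup>2 \<le> (norm (partial_sum F u n x))\<^sup>2 + (norm (partial_sum F u n y))\<^sup>2"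
    using operators_large_at_common_point[of "partial_sum F u" a "I \<inter> {N..}" \<delta> 2]
      bounded_linear_partial_sum[OF fb] norm a0 tail by auto
  have "((\<lambda>n. (norm (partial_sum F u n x))\<^sup>2 + (norm (partial_sum F u n y))\<^sup>2)
      \<longlongrightarrow> (norm x)\<^sup>2 + (norm y)\<^sup>2) F"
    by (intro tendsto_intros partial_sum_tendsto fb)
  moreover have "(norm x)\<^sup>2 + (norm y)\<^sup>2 < 4" using xy(1) by (simp add: \<delta>_def)
  ultimately have "\<forall>\<^sub>F n in F. (norm (partial_sum F u n x))\<^sup>2 + (norm (partial_sum F u n y))\<^sup>2 < 4"
    by (rule order_tendstoD(2))
  moreover have "\<forall>\<^sub>F n in F. n \<ge> N"
    using free_filter_le_sequentially[OF free] eventually_ge_at_top filter_leD by blast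
  ultimately have "\<forall>\<^sub>F n in F. n \<in> {n. (norm (partial_sum F u n x))\<^sup>2
      + (norm (partial_sum F u n y))\<^sup>2 < 4} \<inter> {N..}"
    by eventually_elim auto
  then obtain n where "n \<in> I" "n \<ge> N"
    "(norm (partial_sum F u n x))\<^sup>2 + (norm (partial_sum F u n y))\<^sup>2 < 4"
    using I unfolding stationary_def by blast
  then show False using xy(2)[of n] by simp
qed

section \<open>A filter basis with prescribed norms\<close>

lift_definition unit_vector :: "nat \<Rightarrow> ell2" is "\<lambda>k n. if n = k then 1 else 0"
proof -
  fix k :: nat
  show "summable (\<lambda>n. (if n = k then 1 else 0 :: real)\<^sup>2)"
    by (rule summable_finite[of "{k}"]) auto
qed

lemma inner_unit_vector: "x \<bullet> unit_vector k = Rep_ell2 x k"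
proof -
  have "(\<Sum>n. Rep_ell2 x n * (if n = k then 1 else 0)) = (\<Sum>n\<in>{k}. Rep_ell2 x n * (if n = k then 1 else 0))"
    by (rule suminf_finite) auto
  then show ?thesis by (simp add: inner_ell2.rep_eq unit_vector.rep_eq)
qed

lemma norm_unit_vector: "norm (unit_vector k) = 1"
  by (simp add: norm_eq_sqrt_inner inner_unit_vector unit_vector.rep_eq)

lemma Rep_ell2_sum: "Rep_ell2 (\<Sum>k\<in>A. f k) n = (\<Sum>k\<in>A. Rep_ell2 (f k) n)"
  by (induction A rule: infinite_finite_induct) (auto simp: zero_ell2.rep_eq plus_ell2.rep_eq)

lemmas Rep_ell2_simps =
  zero_ell2.rep_eq plus_ell2.rep_eq minus_ell2.rep_eq scaleR_ell2.rep_eq unit_vector.rep_eq Rep_ell2_sum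

lemma ell2_infinite_dimensional: "infinite_dimensional (UNIV :: ell2 set)"
  unfolding infinite_dimensional_def
proof
  assume "\<exists>B::ell2 set. finite B \<and> UNIV \<subseteq> span B"
  then obtain B :: "ell2 set" where B: "finite B" "UNIV \<subseteq> span B" by blast
  have rep: "Rep_ell2 (unit_vector k) n = (if n = k then 1 else 0)" for k n
    by (simp add: unit_vector.rep_eq)
  have inj: "inj unit_vector"
    by (rule injI) (metis rep zero_neq_one)
  have "independent (range unit_vector)"
  proof (rule pairwise_orthogonal_independent)
    show "pairwise orthogonal (range unit_vector)"
      by (auto simp: pairwise_def orthogonal_def inner_unit_vector rep)
    show "0 \<notin> range unit_vector"
      by (metis (mono_tags, lifting) imageE rep zero_ell2.rep_eq zero_neq_one)
  qed
  then have "finite (range unit_vector)"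
    using independent_span_bound[OF B(1)] B(2) by blast
  then show False using inj finite_imageD infinite_UNIV_nat by blast
qed

definition truncation :: "nat \<Rightarrow> ell2 \<Rightarrow> ell2" where
  "truncation n x = (\<Sum>k\<le>n. Rep_ell2 x k *\<^sub>R unit_vector k)"

lemma Rep_truncation: "Rep_ell2 (truncation n x) k = (if k \<le> n then Rep_ell2 x k else 0)"
proof -
  have "Rep_ell2 (truncation n x) k = (\<Sum>j\<le>n. if k = j then Rep_ell2 x j else 0)"
    unfolding truncation_def Rep_ell2_simps by (intro sum.cong) auto
  then show ?thesis by simp
qed

lemma norm_truncation_square: "(norm (truncation n x))\<^sup>2 = (\<Sum>k\<le>n. (Rep_ell2 x k)\<^sup>2)"
proof -
  have "(norm (truncation n x))\<^sup>2 = (\<Sum>k\<in>{..n}. (Rep_ell2 (truncation n x) k)\<^sup>2)"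
    unfolding norm_ell2_square by (rule suminf_finite) (auto simp: Rep_truncation)
  then show ?thesis by (simp add: Rep_truncation)
qed

lemma truncation_tendsto: "(\<lambda>n. truncation n x) \<longlonglongrightarrow> x"
proof -
  have sq: "(norm (truncation n x - x))\<^sup>2 = (norm x)\<^sup>2 - (\<Sum>k\<le>n. (Rep_ell2 x k)\<^sup>2)" for n
  proof -
    have "truncation n x \<bullet> x = (\<Sum>k\<le>n. (Rep_ell2 x k)\<^sup>2)"
      unfolding truncation_def inner_sum_left
      by (intro sum.cong) (auto simp: inner_commute[of _ x] inner_unit_vector power2_eq_square)
    then show ?thesis
      using norm_truncation_square[of n x] unfolding power2_norm_eq_inner
      by (simp add: inner_diff_left inner_diff_right inner_commute)
  qed
  have "(\<lambda>n. \<Sum>k<Suc n. (Rep_ell2 x k)\<^sup>2) \<longlonglongrightarrow> (norm x)\<^sup>2"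
    unfolding norm_ell2_square
    by (rule LIMSEQ_Suc[OF summable_LIMSEQ[OF coord_square_summable]])
  then have "(\<lambda>n. (norm x)\<^sup>2 - (\<Sum>k\<le>n. (Rep_ell2 x k)\<^sup>2)) \<longlonglongrightarrow> (norm x)\<^sup>2 - (norm x)\<^sup>2"
    by (intro tendsto_diff tendsto_const) (simp add: lessThan_Suc_atMost)
  then have "(\<lambda>n. sqrt ((norm (truncation n x - x))\<^sup>2)) \<longlonglongrightarrow> sqrt 0"
    unfolding sq by (intro tendsto_real_sqrt) simp
  then have "(\<lambda>n. norm (truncation n x - x)) \<longlonglongrightarrow> 0" by simp
  then show ?thesis
    using LIM_zero_cancel tendsto_norm_zero_iff by blast
qed

fun basis_vector :: "(nat \<Rightarrow> real) \<Rightarrow> nat \<Rightarrow> ell2" where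
  "basis_vector g 0 = unit_vector 0"
| "basis_vector g (Suc n) = unit_vector (Suc n) - g n *\<^sub>R basis_vector g n"

definition basis_coordinate :: "(nat \<Rightarrow> real) \<Rightarrow> nat \<Rightarrow> ell2 \<Rightarrow> real" where
  "basis_coordinate g k x = Rep_ell2 x k + g k * Rep_ell2 x (Suc k)"

lemma Rep_basis_vector_above: "k > n \<Longrightarrow> Rep_ell2 (basis_vector g n) k = 0"
  by (induction n) (auto simp: Rep_ell2_simps)

lemma Rep_basis_vector_diag: "Rep_ell2 (basis_vector g n) n = 1"
  by (cases n) (auto simp: Rep_ell2_simps Rep_basis_vector_above)

lemma basis_coordinate_basis_vector:
  "basis_coordinate g k (basis_vector g n) = (if k = n then 1 else 0)"
proof (induction n)
  case 0
  then show ?case by (simp add: basis_coordinate_def Rep_ell2_simps)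
next
  case (Suc n)
  have "basis_coordinate g k (basis_vector g (Suc n))
      = basis_coordinate g k (unit_vector (Suc n)) - g n * basis_coordinate g k (basis_vector g n)"
    by (simp add: basis_coordinate_def Rep_ell2_simps algebra_simps)
  then show ?case
    using Suc by (auto simp: basis_coordinate_def Rep_ell2_simps)
qed

lemma bounded_linear_basis_coordinate: "bounded_linear (basis_coordinate g k)"
proof -
  have "bounded_linear (\<lambda>x. x \<bullet> unit_vector k + g k * (x \<bullet> unit_vector (Suc k)))"
    by (intro bounded_linear_add bounded_linear_const_mult bounded_linear_inner_left)
  then show ?thesis by (simp add: inner_unit_vector basis_coordinate_def[abs_def])
qed

text \<open>
  The sum telescopes, as \<open>g n *\<^sub>R u n + u (n + 1)\<close> is the unit vector with index \<open>n + 1\<close> for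
  \<open>u = basis_vector g\<close>.
\<close>

lemma basis_partial_sum:
  "(\<Sum>k\<le>n. basis_coordinate g k x *\<^sub>R basis_vector g k)
     = truncation n x + (g n * Rep_ell2 x (Suc n)) *\<^sub>R basis_vector g n"
  by (induction n) (auto simp: truncation_def basis_coordinate_def algebra_simps)

lemma filter_basis_from_weights:
  assumes free: "free_filter F"
    and small: "\<And>x. ((\<lambda>n. g n * norm (basis_vector g n) * Rep_ell2 x (Suc n)) \<longlongrightarrow> 0) F"
  shows "filter_basis F (basis_vector g)" "coordinate F (basis_vector g) k = basis_coordinate g k"
proof -
  have F: "F \<noteq> bot" using free by (simp add: free_filter_def)
  have seq: "(f \<longlongrightarrow> l) F" if "f \<longlonglongrightarrow> l" for f :: "nat \<Rightarrow> 'b::topological_space" and l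
    using that free_filter_le_sequentially[OF free] tendsto_mono by blast
  have ex: "((\<lambda>n. \<Sum>k\<le>n. basis_coordinate g k x *\<^sub>R basis_vector g k) \<longlongrightarrow> x) F" for x
  proof -
    have "((\<lambda>n. norm ((g n * Rep_ell2 x (Suc n)) *\<^sub>R basis_vector g n)) \<longlongrightarrow> 0) F"
      using tendsto_rabs_zero[OF small[of x]] by (simp add: abs_mult mult_ac)
    then have "((\<lambda>n. (g n * Rep_ell2 x (Suc n)) *\<^sub>R basis_vector g n) \<longlongrightarrow> 0) F"
      by (simp only: tendsto_norm_zero_iff)
    from tendsto_add[OF seq[OF truncation_tendsto] this, of x]
    show ?thesis by (simp only: basis_partial_sum add_0_right)
  qed
  have unique: "c = (\<lambda>k. basis_coordinate g k x)"
    if c: "((\<lambda>n. \<Sum>k\<le>n. c k *\<^sub>R basis_vector g k) \<longlongrightarrow> x) F" for c x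
  proof
    fix k
    interpret f: bounded_linear "basis_coordinate g k" by (rule bounded_linear_basis_coordinate)
    have "basis_coordinate g k (\<Sum>j\<le>n. c j *\<^sub>R basis_vector g j) = c k" if "n \<ge> k" for n
    proof -
      have "basis_coordinate g k (\<Sum>j\<le>n. c j *\<^sub>R basis_vector g j) = (\<Sum>j\<le>n. if k = j then c j else 0)"
        unfolding f.sum f.scaleR basis_coordinate_basis_vector by (intro sum.cong) auto
      then show ?thesis using that by simp
    qed
    then have "\<forall>\<^sub>F n in sequentially. basis_coordinate g k (\<Sum>j\<le>n. c j *\<^sub>R basis_vector g j) = c k"
      by (auto simp: eventually_sequentially)
    then have "((\<lambda>n. basis_coordinate g k (\<Sum>j\<le>n. c j *\<^sub>R basis_vector g j)) \<longlongrightarrow> c k) F"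
      by (intro seq tendsto_eventually)
    with f.tendsto[OF c] show "c k = basis_coordinate g k x"
      using tendsto_unique[OF F] by blast
  qed
  show "filter_basis F (basis_vector g)"
    unfolding filter_basis_def
  proof
    fix x
    show "\<exists>!c. ((\<lambda>n. \<Sum>k\<le>n. c k *\<^sub>R basis_vector g k) \<longlongrightarrow> x) F"
      by (rule ex1I[where a = "\<lambda>k. basis_coordinate g k x"]) (fact ex, fact unique)
  qed
  have "(THE c. ((\<lambda>n. \<Sum>k\<le>n. c k *\<^sub>R basis_vector g k) \<longlongrightarrow> x) F) = (\<lambda>k. basis_coordinate g k x)" for x
    by (rule the_equality) (fact ex, fact unique)
  then show "coordinate F (basis_vector g) k = basis_coordinate g k"
    by (simp add: coordinate_def fun_eq_iff)
qed

text \<open>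
  The upper bound is the Cauchy-Schwarz inequality for the orthogonal components of \<open>x\<close> in the first
  \<open>n + 1\<close> coordinates and in the next one. With \<open>v = g n *\<^sub>R basis_vector g n\<close>, equality occurs at
  \<open>v + (norm v)\<^sup>2 e\<close>, where \<open>e\<close> is the unit vector with index \<open>n + 1\<close>, unless \<open>v = 0\<close>.
\<close>

lemma onorm_partial_sum:
  "onorm (\<lambda>x. truncation n x + (g n * Rep_ell2 x (Suc n)) *\<^sub>R basis_vector g n)
     = sqrt (1 + (norm (g n *\<^sub>R basis_vector g n))\<^sup>2)" (is "onorm ?S = ?a")
proof (rule antisym)
  define v where "v = g n *\<^sub>R basis_vector g n"
  have S: "?S x = truncation n x + Rep_ell2 x (Suc n) *\<^sub>R v" for x
    by (simp add: v_def mult.commute)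
  have v_above: "Rep_ell2 v k = 0" if "k > n" for k
    using that by (simp add: v_def Rep_ell2_simps Rep_basis_vector_above)
  have bound: "norm (?S x) \<le> ?a * norm x" for x
  proof -
    let ?p = "norm (truncation n x)" and ?s = "\<bar>Rep_ell2 x (Suc n)\<bar>"
    have "?p\<^sup>2 + ?s\<^sup>2 = (\<Sum>k<Suc (Suc n). (Rep_ell2 x k)\<^sup>2)"
      by (simp add: norm_truncation_square lessThan_Suc_atMost[symmetric])
    also have "\<dots> \<le> (norm x)\<^sup>2" by (rule sum_coord_le_norm_ell2)
    finally have le: "?p\<^sup>2 + ?s\<^sup>2 \<le> (norm x)\<^sup>2" .
    have "norm (?S x) \<le> ?p + ?s * norm v"
      unfolding S using norm_triangle_ineq[of "truncation n x" "Rep_ell2 x (Suc n) *\<^sub>R v"] by simp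
    also have "\<dots> \<le> ?a * norm x"
    proof (rule power2_le_imp_le)
      have "(?p + ?s * norm v)\<^sup>2 \<le> (1 + (norm v)\<^sup>2) * (?p\<^sup>2 + ?s\<^sup>2)"
        using zero_le_power2[of "?p * norm v - ?s"] by (simp add: power2_eq_square algebra_simps)
      also have "\<dots> \<le> (1 + (norm v)\<^sup>2) * (norm x)\<^sup>2"
        using le by (intro mult_left_mono) auto
      finally show "(?p + ?s * norm v)\<^sup>2 \<le> (?a * norm x)\<^sup>2"
        by (simp add: power_mult_distrib v_def)
    qed simp
    finally show ?thesis .
  qed
  show "onorm ?S \<le> ?a"
    by (rule onorm_bound[OF _ bound]) simp
  have bl: "bounded_linear ?S"
  proof -
    have "bounded_linear (\<lambda>x. \<Sum>k\<le>n. basis_coordinate g k x *\<^sub>R basis_vector g k)"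
      by (intro bounded_linear_sum bounded_linear_scaleR_const bounded_linear_basis_coordinate)
    then show ?thesis by (simp only: basis_partial_sum)
  qed
  show "?a \<le> onorm ?S"
  proof (cases "v = 0")
    case True
    have "?S (unit_vector 0) = unit_vector 0"
      unfolding S using True
      by (intro Rep_ell2_inject[THEN iffD1] ext) (simp add: Rep_ell2_simps Rep_truncation)
    moreover have "?a = 1" by (simp only: v_def[symmetric] True) simp
    ultimately show ?thesis
      using onorm[OF bl, of "unit_vector 0"] by (simp only: norm_unit_vector mult_1_right)
  next
    case False
    define x where "x = v + (norm v)\<^sup>2 *\<^sub>R unit_vector (Suc n)"
    have "?S x = (1 + (norm v)\<^sup>2) *\<^sub>R v"
      unfolding S by (intro Rep_ell2_inject[THEN iffD1] ext)
        (auto simp: x_def Rep_ell2_simps Rep_truncation v_above algebra_simps)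
    moreover have "(norm x)\<^sup>2 = (1 + (norm v)\<^sup>2) * (norm v)\<^sup>2"
    proof -
      have "v \<bullet> unit_vector (Suc n) = 0" by (simp add: inner_unit_vector v_above)
      moreover have "unit_vector (Suc n) \<bullet> unit_vector (Suc n) = 1"
        by (simp add: inner_unit_vector unit_vector.rep_eq)
      ultimately show ?thesis
        unfolding x_def power2_norm_eq_inner
        by (simp add: inner_simps inner_commute[of "unit_vector (Suc n)" v] distrib_right)
    qed
    moreover have a2: "?a\<^sup>2 = 1 + (norm v)\<^sup>2"
      unfolding v_def by (rule real_sqrt_pow2) simp
    ultimately have "(norm x)\<^sup>2 = (?a * norm v)\<^sup>2" "norm (?S x) = ?a * (?a * norm v)"
      by (simp_all only: power_mult_distrib) (simp only: mult.assoc[symmetric]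
          power2_eq_square[symmetric] norm_scaleR abs_of_nonneg[OF add_nonneg_nonneg[OF zero_le_one zero_le_power2]])
    moreover have a0: "?a > 0" by (simp add: add_pos_nonneg)
    ultimately have "?a * (?a * norm v) \<le> onorm ?S * (?a * norm v)"
      using onorm[OF bl, of x] power2_eq_imp_eq[of "norm x" "?a * norm v"] by simp
    moreover have "?a * norm v > 0" using a0 False by (intro mult_pos_pos) auto
    ultimately show ?thesis by (simp only: mult_le_cancel_right_pos)
  qed
qed

text \<open>
  Since \<open>basis_vector g (n + 1)\<close> is the orthogonal sum of a unit vector and \<open>- g n *\<^sub>R basis_vector g n\<close>,
  its norm is the operator norm \<open>a n\<close> of the preceding partial sum. The next weight only has to
  satisfy \<open>1 + (g (n + 1) * a n)\<^sup>2 = (a (n + 1))\<^sup>2\<close>.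
\<close>

fun weight :: "(nat \<Rightarrow> real) \<Rightarrow> nat \<Rightarrow> real" where
  "weight a 0 = sqrt ((a 0)\<^sup>2 - 1)"
| "weight a (Suc n) = sqrt ((a (Suc n))\<^sup>2 - 1) / a n"

lemma norm_weight_basis_vector:
  assumes "\<And>n. a n \<ge> 1"
  shows "(norm (weight a n *\<^sub>R basis_vector (weight a) n))\<^sup>2 = (a n)\<^sup>2 - 1"
proof (induction n)
  case 0
  show ?case using assms[of 0] by (simp add: power_mult_distrib norm_unit_vector)
next
  case (Suc n)
  let ?v = "weight a n *\<^sub>R basis_vector (weight a) n"
  have orth: "?v \<bullet> unit_vector (Suc n) = 0"
    by (simp add: inner_unit_vector Rep_ell2_simps Rep_basis_vector_above del: inner_scaleR_left)
  have "(norm (unit_vector (Suc n) - ?v))\<^sup>2 = 1 + (norm ?v)\<^sup>2"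
  proof -
    have "0 = ((norm ?v)\<^sup>2 + 1 - (norm (unit_vector (Suc n) - ?v))\<^sup>2) / 2"
      using dot_norm_neg[of ?v "unit_vector (Suc n)"]
      unfolding orth norm_unit_vector norm_minus_commute[of ?v] power_one .
    moreover have "A = 1 + B" if "0 = (B + 1 - A) / 2" for A B :: real
      using that by simp
    ultimately show ?thesis by blast
  qed
  then have "(norm (basis_vector (weight a) (Suc n)))\<^sup>2 = (a n)\<^sup>2"
    using Suc by simp
  moreover have "(weight a (Suc n))\<^sup>2 * (a n)\<^sup>2 = (a (Suc n))\<^sup>2 - 1"
    using assms[of n] assms[of "Suc n"] by (simp add: power_divide)
  ultimately show ?case
    by (simp only: norm_scaleR power_mult_distrib power2_abs)
qed

text \<open>
  By Chebyshev's inequality, the squares \<open>1 / (a n)\<^sup>2\<close> have a finite sum over the set of \<open>n\<close> where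
  \<open>\<bar>a n * x n\<bar> \<ge> e\<close>. So this set is not stationary, that is, it misses a member of \<open>F\<close>.
\<close>

lemma admissible_imp_filter_tendsto_0:
  assumes adm: "admissible F 2 a" and a: "\<And>n. a n > 0" and x: "summable (\<lambda>n. (x n)\<^sup>2)"
  shows "((\<lambda>n. a n * x n) \<longlongrightarrow> (0::real)) F"
proof (rule tendstoI)
  fix e :: real assume e: "e > 0"
  define I where "I = {n. e \<le> \<bar>a n * x n\<bar>}"
  define C where "C = (\<Sum>n. (x n)\<^sup>2) / e\<^sup>2"
  have "(\<Sum>n\<in>J. ennreal (a n powr (- 2))) \<le> ennreal C" if "finite J" "J \<subseteq> I" for J
  proof -
    have "a n powr (- 2) \<le> (x n)\<^sup>2 / e\<^sup>2" if "n \<in> J" for n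
    proof -
      have "e\<^sup>2 \<le> (\<bar>a n * x n\<bar>)\<^sup>2"
        using \<open>J \<subseteq> I\<close> that e by (intro power_mono) (auto simp: I_def)
      then have "e\<^sup>2 \<le> (a n)\<^sup>2 * (x n)\<^sup>2" by (simp add: power_mult_distrib)
      then show ?thesis using e a[of n] by (simp add: powr_minus field_simps)
    qed
    then have "(\<Sum>n\<in>J. a n powr (- 2)) \<le> (\<Sum>n\<in>J. (x n)\<^sup>2 / e\<^sup>2)" by (rule sum_mono)
    also have "\<dots> = (\<Sum>n\<in>J. (x n)\<^sup>2) / e\<^sup>2" by (simp add: sum_divide_distrib)
    also have "\<dots> \<le> C"
      unfolding C_def using x that by (intro divide_right_mono sum_le_suminf) auto
    finally show ?thesis by (simp add: sum_ennreal ennreal_leI)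
  qed
  then have "(\<Sum>\<^sub>\<infinity>n\<in>I. ennreal (a n powr (- 2))) \<le> ennreal C"
    using nonneg_infsum_complete[of I "\<lambda>n. ennreal (a n powr (- 2))"] by (auto intro!: SUP_least)
  then have "(\<Sum>\<^sub>\<infinity>n\<in>I. ennreal (a n powr (- 2))) \<noteq> \<infinity>"
    by (metis ennreal_less_top infinity_ennreal_def not_less top.extremum_unique)
  then have "\<not> stationary F I" using adm by (auto simp: admissible_def)
  then obtain A where A: "\<forall>\<^sub>F n in F. n \<in> A" "I \<inter> A = {}" by (auto simp: stationary_def)
  from A(1) show "\<forall>\<^sub>F n in F. dist (a n * x n) 0 < e"
    by (rule eventually_mono) (use A(2) in \<open>force simp: I_def not_le[symmetric]\<close>)
qed

lemma filter_basis_from_admissible: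
  assumes "free_filter F" and a: "\<And>n. a n > 1" and adm: "admissible F 2 a"
  shows "hilbert_filter_basis_with_norms F a (basis_vector (weight a))"
proof -
  let ?g = "weight a"
  have norm_sq: "(norm (?g n *\<^sub>R basis_vector ?g n))\<^sup>2 = (a n)\<^sup>2 - 1" for n
    using norm_weight_basis_vector[of a n, OF less_imp_le[OF a]] .
  have "((\<lambda>n. ?g n * norm (basis_vector ?g n) * Rep_ell2 x (Suc n)) \<longlongrightarrow> 0) F" for x
  proof (rule Lim_null_comparison)
    have "summable (\<lambda>n. (Rep_ell2 x (Suc n))\<^sup>2)"
      using coord_square_summable[of x] by (subst summable_Suc_iff)
    then have "((\<lambda>n. a n * Rep_ell2 x (Suc n)) \<longlongrightarrow> 0) F"
      using admissible_imp_filter_tendsto_0[OF adm, of "\<lambda>n. Rep_ell2 x (Suc n)"] a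
      by (meson less_trans zero_less_one)
    then show "((\<lambda>n. \<bar>a n * Rep_ell2 x (Suc n)\<bar>) \<longlongrightarrow> 0) F"
      by (rule tendsto_rabs_zero)
    have "\<bar>?g n\<bar> * norm (basis_vector ?g n) \<le> a n" for n
    proof (rule power2_le_imp_le)
      show "(\<bar>?g n\<bar> * norm (basis_vector ?g n))\<^sup>2 \<le> (a n)\<^sup>2" using norm_sq[of n] by simp
      show "0 \<le> a n" using a[of n] by simp
    qed
    then have "norm (?g n * norm (basis_vector ?g n) * Rep_ell2 x (Suc n)) \<le> \<bar>a n * Rep_ell2 x (Suc n)\<bar>" for n
      using mult_right_mono[of "\<bar>?g n\<bar> * norm (basis_vector ?g n)" "a n" "\<bar>Rep_ell2 x (Suc n)\<bar>"]
        a[of n] by (simp add: abs_mult)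
    then show "\<forall>\<^sub>F n in F. norm (?g n * norm (basis_vector ?g n) * Rep_ell2 x (Suc n))
        \<le> \<bar>a n * Rep_ell2 x (Suc n)\<bar>" by simp
  qed
  note basis = filter_basis_from_weights[OF assms(1) this]
  have "onorm (partial_sum F (basis_vector ?g) n) = a n" for n
  proof -
    have "partial_sum F (basis_vector ?g) n
        = (\<lambda>x. truncation n x + (?g n * Rep_ell2 x (Suc n)) *\<^sub>R basis_vector ?g n)"
      by (rule ext) (simp only: partial_sum_def basis(2) basis_partial_sum)
    then show ?thesis
      using a[of n] by (simp only: onorm_partial_sum norm_sq) simp
  qed
  then show ?thesis
    unfolding hilbert_filter_basis_with_norms_def
    using ell2_infinite_dimensional basis
      linear_continuous_on[OF bounded_linear_basis_coordinate] by simp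
qed

theorem theorem4p6:
  fixes F :: "nat filter" and a :: "nat \<Rightarrow> real"
  assumes "free_filter F" and "\<And>n. a n > 1"
  shows "((\<exists>u :: nat \<Rightarrow> 'h::{real_inner, banach}. hilbert_filter_basis_with_norms F a u)
            \<longrightarrow> admissible F 2 a) \<and>
         (admissible F 2 a
            \<longrightarrow> (\<exists>u :: nat \<Rightarrow> ell2. hilbert_filter_basis_with_norms F a u))"
  using filter_basis_imp_admissible[of F a] filter_basis_from_admissible[of F a] assms by blast

end
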